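(* ($N$-fold Darboux transformation.) Let $\sigma=\pm1$ and let $(u_1,u_2)$ be a smooth solution of the coupled Fokas–Lenells equation $$u_{1,xt}+u_1+\mathrm i(|u_1|^2+\tfrac12\sigma|u_2|^2)u_{1,x}+\tfrac{\mathrm i}{2}\sigma u_1u_2^*u_{2,x}=0,\qquad u_{2,xt}+u_2+\mathrm i(\sigma|u_2|^2+\tfrac12|u_1|^2)u_{2,x}+\tfrac{\mathrm i}{2}u_2u_1^*u_{1,x}=0.$$ Let $\lambda_1,\dots,\lambda_N\in\mathbb C\setminus(\mathbb R\cup\mathrm i\mathbb R)$ with $\lambda_i^2\neq\lambda_j^2$ for $i\ne j$ and $(\lambda_i^{*})^2\ne\lambda_j^2$ for all $i,j$, and let $|y_i\rangle=(\varphi_i,\psi_i,\chi_i)^{\mathrm T}$ be a solution of the Lax pair (see context) at $\lambda=\lambda_i$, with $\langle y_i|=|y_i\rangle^\dagger$. Put $J=\mathrm{diag}(1,-1,-\sigma)$, $$b_{ij}=\frac{\langle y_i|J|y_j\rangle}{\lambda_i^*-\lambda_j}+\frac{\langle y_i|J\sigma_3|y_j\rangle}{\lambda_i^*+\lambda_j},\qquad m_{ij}=\frac{\langle y_i|J|y_j\rangle}{\lambda_i^*-\lambda_j}-\frac{\langle y_i|J\sigma_3|y_j\rangle}{\lambda_i^*+\lambda_j},$$ $B=(b_{ij})_{N\times N}$, $M=(m_{ij})_{N\times N}$, and work where $B$ and $M$ are invertible. Define vectors $|x_i\rangle$ with components $|x_{i,k}\rangle$ by $[|x_{1,1}\rangle,\dots,|x_{N,1}\rangle]=[|y_{1,1}\rangle,\dots,|y_{N,1}\rangle]B^{-1}$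 and $[|x_{1,k}\rangle,\dots,|x_{N,k}\rangle]=[|y_{1,k}\rangle,\dots,|y_{N,k}\rangle]M^{-1}$ for $k=2,3$, put $A_i=|x_i\rangle\langle y_i|J$ and $$T_N(\lambda)=I+\sum_{i=1}^N\Big[\frac{A_i}{\lambda-\lambda_i^*}-\frac{\sigma_3A_i\sigma_3}{\lambda+\lambda_i^*}\Big].$$ Then $T_N$ maps solutions $\Phi$ of the Lax pair with potential $Q$ to solutions $\Phi[N]=T_N\Phi$ of the Lax pair of the same form with $Q$ replaced by $Q[N]=Q+\sum_{i=1}^N(A_i-\sigma_3A_i\sigma_3)$; equivalently, the functions $$\begin{pmatrix} u_1[N] \\ u_2[N] \end{pmatrix}=\begin{pmatrix} u_1 \\ u_2 \end{pmatrix}+2Y_2M^{-1}Y_1^\dagger,\qquad Y_1=(\varphi_1,\dots,\varphi_N),\quad Y_2=\begin{pmatrix}\psi_1&\cdots&\psi_N \\ \chi_1&\cdots&\chi_N\end{pmatrix},$$ again solve the coupled Fokas–Lenells equation.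
   Context: The Lax pair is $\Phi_x=U\Phi$, $\Phi_t=V\Phi$ with $U=\mathrm i\lambda^{-2}\sigma_3+\lambda^{-1}Q_x$, $V=\mathrm i\big(\frac14\lambda^2\sigma_3+\frac12\sigma_3(Q^2-\lambda Q)\big)$, $\sigma_3=\mathrm{diag}(1,-1,-1)$, $Q=\begin{pmatrix} 0&u_1^*&\sigma u_2^* \\ u_1&0&0 \\ u_2&0&0 \end{pmatrix}$. $^*$ is complex conjugation, $^\dagger$ conjugate transpose; $|x_{i,k}\rangle,|y_{i,k}\rangle$ denote the $k$-th components of $|x_i\rangle,|y_i\rangle$. *)

theory Defs
  imports "HOL-Analysis.Analysis"
begin

section \<open>Functions of the two real variables \<open>(x, t)\<close>\<close>

definition dx :: "(real \<times> real \<Rightarrow> 'a::real_normed_vector) \<Rightarrow> real \<times> real \<Rightarrow> 'a" where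
  "dx f p = vector_derivative (\<lambda>s. f (s, snd p)) (at (fst p))"

definition dt :: "(real \<times> real \<Rightarrow> 'a::real_normed_vector) \<Rightarrow> real \<times> real \<Rightarrow> 'a" where
  "dt f p = vector_derivative (\<lambda>s. f (fst p, s)) (at (snd p))"

text \<open>\<open>Ck_on k S f\<close> is meant for open \<open>S\<close>: all partial derivatives of \<open>f\<close> of order at most \<open>k\<close>
  exist and are continuous on \<open>S\<close>. Differentiability is demanded explicitly because
  \<open>vector_derivative\<close> is total.\<close>

primrec Ck_on :: "nat \<Rightarrow> (real \<times> real) set \<Rightarrow> (real \<times> real \<Rightarrow> 'a::real_normed_vector) \<Rightarrow> bool" where
  "Ck_on 0 S f \<longleftrightarrow> continuous_on S f"
| "Ck_on (Suc k) S f \<longleftrightarrow> (\<forall>p\<in>S. f differentiable (at p)) \<and> Ck_on k S (dx f) \<and> Ck_on k S (dt f)"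

definition smooth_on :: "(real \<times> real) set \<Rightarrow> (real \<times> real \<Rightarrow> 'a::real_normed_vector) \<Rightarrow> bool" where
  "smooth_on S f \<longleftrightarrow> (\<forall>k. Ck_on k S f)"


section \<open>The coupled Fokas--Lenells equation and its Lax pair\<close>

text \<open>Here \<open>w * cnj w\<close> stands for \<open>\<bar>w\<bar>\<^sup>2\<close>.\<close>

definition smooth_cFL_solution ::
    "complex \<Rightarrow> (real \<times> real) set \<Rightarrow> (real \<times> real \<Rightarrow> complex) \<Rightarrow> (real \<times> real \<Rightarrow> complex) \<Rightarrow> bool" where
  "smooth_cFL_solution \<sigma> S u1 u2 \<longleftrightarrow>
     smooth_on S u1 \<and> smooth_on S u2 \<and>
     (\<forall>p\<in>S.
        dt (dx u1) p + u1 p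
          + \<i> * (u1 p * cnj (u1 p) + \<sigma> / 2 * (u2 p * cnj (u2 p))) * dx u1 p
          + \<i> / 2 * \<sigma> * u1 p * cnj (u2 p) * dx u2 p = 0 \<and>
        dt (dx u2) p + u2 p
          + \<i> * (\<sigma> * (u2 p * cnj (u2 p)) + 1 / 2 * (u1 p * cnj (u1 p))) * dx u2 p
          + \<i> / 2 * u2 p * cnj (u1 p) * dx u1 p = 0)"

text \<open>The spectral parameter is written \<open>\<zeta>\<close>; \<open>mat c ** A\<close> is the scalar multiple \<open>c A\<close> of a matrix.\<close>

definition sigma3 :: "complex^3^3" where
  "sigma3 = vector [vector [1, 0, 0], vector [0, -1, 0], vector [0, 0, -1]]"

definition Qmat :: "complex \<Rightarrow> complex \<Rightarrow> complex \<Rightarrow> complex^3^3" where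
  "Qmat \<sigma> a b = vector [vector [0, cnj a, \<sigma> * cnj b], vector [a, 0, 0], vector [b, 0, 0]]"

definition lax_U :: "(real \<times> real \<Rightarrow> complex^3^3) \<Rightarrow> complex \<Rightarrow> real \<times> real \<Rightarrow> complex^3^3" where
  "lax_U Q \<zeta> p = mat (\<i> / \<zeta>\<^sup>2) ** sigma3 + mat (1 / \<zeta>) ** dx Q p"

definition lax_V :: "(real \<times> real \<Rightarrow> complex^3^3) \<Rightarrow> complex \<Rightarrow> real \<times> real \<Rightarrow> complex^3^3" where
  "lax_V Q \<zeta> p =
     mat \<i> ** (mat (\<zeta>\<^sup>2 / 4) ** sigma3 + mat (1 / 2) ** (sigma3 ** (Q p ** Q p - mat \<zeta> ** Q p)))"

definition lax_solution ::
    "(real \<times> real \<Rightarrow> complex^3^3) \<Rightarrow> complex \<Rightarrow> (real \<times> real) set \<Rightarrow> (real \<times> real \<Rightarrow> complex^3) \<Rightarrow> bool" where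
  "lax_solution Q \<zeta> S \<Phi> \<longleftrightarrow>
     (\<forall>p\<in>S. \<Phi> differentiable (at p) \<and>
        dx \<Phi> p = lax_U Q \<zeta> p *v \<Phi> p \<and> dt \<Phi> p = lax_V Q \<zeta> p *v \<Phi> p)"


section \<open>The \<open>N\<close>-fold Darboux transformation\<close>

text \<open>The index set \<open>{1, \<dots>, N}\<close> is a finite type \<open>'n\<close>. The following constructions are pointwise
  in \<open>(x, t)\<close>: \<open>y i\<close> is the value of the \<open>i\<close>-th vector at a given point.\<close>

definition Jmat :: "complex \<Rightarrow> complex^3^3" where
  "Jmat \<sigma> = vector [vector [1, 0, 0], vector [0, -1, 0], vector [0, 0, -\<sigma>]]"

definition braket :: "complex^3 \<Rightarrow> complex^3^3 \<Rightarrow> complex^3 \<Rightarrow> complex" where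
  "braket v A w = (\<Sum>k\<in>UNIV. cnj (v $ k) * (A *v w) $ k)"

definition ketbra :: "complex^3 \<Rightarrow> complex^3 \<Rightarrow> complex^3^3" where
  "ketbra v w = (\<chi> k l. v $ k * cnj (w $ l))"

definition Bmat :: "complex \<Rightarrow> ('n::finite \<Rightarrow> complex) \<Rightarrow> ('n \<Rightarrow> complex^3) \<Rightarrow> complex^'n^'n" where
  "Bmat \<sigma> lam y = (\<chi> i j.
     braket (y i) (Jmat \<sigma>) (y j) / (cnj (lam i) - lam j)
     + braket (y i) (Jmat \<sigma> ** sigma3) (y j) / (cnj (lam i) + lam j))"

definition Mmat :: "complex \<Rightarrow> ('n::finite \<Rightarrow> complex) \<Rightarrow> ('n \<Rightarrow> complex^3) \<Rightarrow> complex^'n^'n" where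
  "Mmat \<sigma> lam y = (\<chi> i j.
     braket (y i) (Jmat \<sigma>) (y j) / (cnj (lam i) - lam j)
     - braket (y i) (Jmat \<sigma> ** sigma3) (y j) / (cnj (lam i) + lam j))"

definition xvec :: "complex \<Rightarrow> ('n::finite \<Rightarrow> complex) \<Rightarrow> ('n \<Rightarrow> complex^3) \<Rightarrow> 'n \<Rightarrow> complex^3" where
  "xvec \<sigma> lam y i = (\<chi> k.
     ((\<chi> j. y j $ k) v* matrix_inv (if k = 1 then Bmat \<sigma> lam y else Mmat \<sigma> lam y)) $ i)"

definition Amat :: "complex \<Rightarrow> ('n::finite \<Rightarrow> complex) \<Rightarrow> ('n \<Rightarrow> complex^3) \<Rightarrow> 'n \<Rightarrow> complex^3^3" where
  "Amat \<sigma> lam y i = ketbra (xvec \<sigma> lam y i) (y i) ** Jmat \<sigma>"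

definition Tmat :: "complex \<Rightarrow> ('n::finite \<Rightarrow> complex) \<Rightarrow> ('n \<Rightarrow> complex^3) \<Rightarrow> complex \<Rightarrow> complex^3^3" where
  "Tmat \<sigma> lam y \<zeta> = mat 1 + (\<Sum>i\<in>UNIV.
     mat (1 / (\<zeta> - cnj (lam i))) ** Amat \<sigma> lam y i
     - mat (1 / (\<zeta> + cnj (lam i))) ** (sigma3 ** Amat \<sigma> lam y i ** sigma3))"

definition Q_dressed ::
    "complex \<Rightarrow> ('n::finite \<Rightarrow> complex) \<Rightarrow> ('n \<Rightarrow> complex^3) \<Rightarrow> complex^3^3 \<Rightarrow> complex^3^3" where
  "Q_dressed \<sigma> lam y q = q + (\<Sum>i\<in>UNIV. Amat \<sigma> lam y i - sigma3 ** Amat \<sigma> lam y i ** sigma3)"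

definition u_dressed ::
    "complex \<Rightarrow> ('n::finite \<Rightarrow> complex) \<Rightarrow> ('n \<Rightarrow> complex^3) \<Rightarrow> complex^2 \<Rightarrow> complex^2" where
  "u_dressed \<sigma> lam y u =
     (let Y1 = (\<chi> j. y j $ 1);
          Y2 = vector [\<chi> j. y j $ 2, \<chi> j. y j $ 3] :: complex^'n^2
      in u + 2 *s ((Y2 ** matrix_inv (Mmat \<sigma> lam y)) *v (\<chi> j. cnj (Y1 $ j))))"

end

theory Submission
  imports Defs
begin

text \<open>
  Write \<open>s\<^sub>k\<close> for the diagonal entries of \<open>\<sigma>\<^sub>3\<close> and \<open>a\<^sub>i\<close> for the conjugate of \<open>\<lambda>\<^sub>i\<close>. For every \<open>\<Phi>\<close> with
  \<open>\<Phi>\<^sub>x = U \<Phi>\<close> a partial fraction computation gives, in each component \<open>k\<close>,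
  \<open>(T \<Phi>)\<^sub>x - U[N] T \<Phi> = \<Sum>\<^sub>i (a\<^sub>i / \<zeta>) w\<^sub>i (\<langle>y\<^sub>i|J|\<Phi>\<rangle> / (\<zeta> - a\<^sub>i) + s\<^sub>k \<langle>y\<^sub>i|J \<sigma>\<^sub>3|\<Phi>\<rangle> / (\<zeta> + a\<^sub>i))\<close>
  with the defect \<open>w\<^sub>i = x\<^sub>i\<^sub>,\<^sub>x - U[N](a\<^sub>i) x\<^sub>i\<close>, provided that \<open>Q[N]\<^sub>x\<close> is the derivative of the dressed potential;
  there is an analogous identity for \<open>V\<close>. At \<open>\<zeta> = \<lambda>\<^sub>j\<close> and \<open>\<Phi> = y\<^sub>j\<close> the left-hand side vanishes, because the
  linear systems that define the \<open>x\<^sub>i\<close> say exactly that \<open>T(\<lambda>\<^sub>j) y\<^sub>j = 0\<close>. Since \<open>B\<close> and \<open>M\<close> are invertible, all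
  defects vanish, and the same identity applied to an arbitrary \<open>\<Phi>\<close> proves the covariance of the Lax pair.

  The covariance alone does not yield the equation for \<open>u[N]\<close>, as this would need enough solutions \<open>\<Phi>\<close>. Instead, the
  equations \<open>x\<^sub>i\<^sub>,\<^sub>x = U[N](a\<^sub>i) x\<^sub>i\<close> and \<open>x\<^sub>i\<^sub>,\<^sub>t = V[N](a\<^sub>i) x\<^sub>i\<close> give the derivatives of the moments
  \<open>\<Sum>\<^sub>i a\<^sub>i\<^sup>n x\<^sub>i\<^sub>,\<^sub>k y\<^sub>i\<^sub>,\<^sub>l\<^sup>*\<close>. The moment with \<open>n = 0\<close>, \<open>l = 1\<close> is half of \<open>u[N] - u\<close>, its \<open>t\<close>-derivative contains
  moments with \<open>n \<le> 2\<close>, and after one more \<open>x\<close>-derivative the higher moments cancel.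
\<close>

section \<open>Calculus in two real variables\<close>

text \<open>The derivative in a direction \<open>e\<close> lets one set of calculus rules serve both
  variables. At points of differentiability, \<open>dx\<close> and \<open>dt\<close> are the
  directions \<open>(1, 0)\<close> and \<open>(0, 1)\<close>.\<close>

definition dderiv :: "real \<times> real \<Rightarrow> (real \<times> real \<Rightarrow> 'a::real_normed_vector) \<Rightarrow> real \<times> real \<Rightarrow> 'a" where
  "dderiv e f p = frechet_derivative f (at p) e"

lemma has_derivative_dderiv:
  "f differentiable (at p) \<Longrightarrow> (f has_derivative (\<lambda>e. dderiv e f p)) (at p)"
  unfolding dderiv_def using frechet_derivative_works by (metis eta_contract_eq)

lemma dderivI: "(f has_derivative f') (at p) \<Longrightarrow> dderiv e f p = f' e"
  unfolding dderiv_def using frechet_derivative_at by metis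

lemma has_vector_derivative_slice_x:
  assumes "f differentiable (at p)"
  shows "((\<lambda>s. f (s, snd p)) has_vector_derivative dderiv (1, 0) f p) (at (fst p))"
proof -
  have "(f has_derivative (\<lambda>e. dderiv e f p)) (at (fst p, snd p))"
    using has_derivative_dderiv[OF assms] by simp
  moreover have "((\<lambda>s. (s, snd p)) has_derivative (\<lambda>s. (s, 0))) (at (fst p))"
    by (auto intro!: derivative_eq_intros)
  ultimately have "((\<lambda>s. f (s, snd p)) has_derivative (\<lambda>s. dderiv (s, 0) f p)) (at (fst p))"
    by (rule has_derivative_compose[rotated])
  moreover have "(\<lambda>s. dderiv (s, 0) f p) = (\<lambda>s. s *\<^sub>R dderiv (1, 0) f p)"
  proof
    fix s :: real
    have "dderiv (s *\<^sub>R (1, 0)) f p = s *\<^sub>R dderiv (1, 0) f p"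
      unfolding dderiv_def by (rule linear_cmul[OF linear_frechet_derivative[OF assms]])
    then show "dderiv (s, 0) f p = s *\<^sub>R dderiv (1, 0) f p" by simp
  qed
  ultimately show ?thesis unfolding has_vector_derivative_def by simp
qed

lemma has_vector_derivative_slice_t:
  assumes "f differentiable (at p)"
  shows "((\<lambda>s. f (fst p, s)) has_vector_derivative dderiv (0, 1) f p) (at (snd p))"
proof -
  have "(f has_derivative (\<lambda>e. dderiv e f p)) (at (fst p, snd p))"
    using has_derivative_dderiv[OF assms] by simp
  moreover have "((\<lambda>s. (fst p, s)) has_derivative (\<lambda>s. (0, s))) (at (snd p))"
    by (auto intro!: derivative_eq_intros)
  ultimately have "((\<lambda>s. f (fst p, s)) has_derivative (\<lambda>s. dderiv (0, s) f p)) (at (snd p))"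
    by (rule has_derivative_compose[rotated])
  moreover have "(\<lambda>s. dderiv (0, s) f p) = (\<lambda>s. s *\<^sub>R dderiv (0, 1) f p)"
  proof
    fix s :: real
    have "dderiv (s *\<^sub>R (0, 1)) f p = s *\<^sub>R dderiv (0, 1) f p"
      unfolding dderiv_def by (rule linear_cmul[OF linear_frechet_derivative[OF assms]])
    then show "dderiv (0, s) f p = s *\<^sub>R dderiv (0, 1) f p" by simp
  qed
  ultimately show ?thesis unfolding has_vector_derivative_def by simp
qed

lemma dx_eq_dderiv: "f differentiable (at p) \<Longrightarrow> dx f p = dderiv (1, 0) f p"
  unfolding dx_def using has_vector_derivative_slice_x vector_derivative_at by blast

lemma dt_eq_dderiv: "f differentiable (at p) \<Longrightarrow> dt f p = dderiv (0, 1) f p"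
  unfolding dt_def using has_vector_derivative_slice_t vector_derivative_at by blast

context
  fixes f g :: "real \<times> real \<Rightarrow> complex" and p :: "real \<times> real"
  assumes f: "f differentiable (at p)" and g: "g differentiable (at p)"
begin

lemma dderiv_add: "dderiv e (\<lambda>q. f q + g q) p = dderiv e f p + dderiv e g p"
  by (rule dderivI) (intro derivative_intros has_derivative_dderiv f g)

lemma dderiv_diff: "dderiv e (\<lambda>q. f q - g q) p = dderiv e f p - dderiv e g p"
  by (rule dderivI) (intro derivative_intros has_derivative_dderiv f g)

lemma dderiv_mult: "dderiv e (\<lambda>q. f q * g q) p = f p * dderiv e g p + dderiv e f p * g p"
  by (rule dderivI) (intro derivative_intros has_derivative_dderiv f g)

end

lemma dderiv_const: "dderiv e (\<lambda>q. c) p = 0"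
  by (simp add: dderiv_def)

text \<open>Here \<open>moment\<close> is only a variable for a filter, unrelated to the moments of
  the last section.\<close>

lemma has_derivative_cnj:
  "(f has_derivative f') moment \<Longrightarrow> ((\<lambda>q. cnj (f q)) has_derivative (\<lambda>e. cnj (f' e))) moment"
  by (rule bounded_linear.has_derivative[OF bounded_linear_cnj])

lemma differentiable_cnj: "f differentiable moment \<Longrightarrow> (\<lambda>q. cnj (f q)) differentiable moment"
  using has_derivative_cnj unfolding differentiable_def by blast

lemma dderiv_cnj: "f differentiable (at p) \<Longrightarrow> dderiv e (\<lambda>q. cnj (f q)) p = cnj (dderiv e f p)"
  by (rule dderivI) (intro has_derivative_cnj has_derivative_dderiv)

lemma dderiv_sum:
  fixes f :: "'i \<Rightarrow> real \<times> real \<Rightarrow> complex"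
  assumes "\<And>i. i \<in> A \<Longrightarrow> f i differentiable (at p)"
  shows "dderiv e (\<lambda>q. \<Sum>i\<in>A. f i q) p = (\<Sum>i\<in>A. dderiv e (f i) p)"
  by (rule dderivI) (intro has_derivative_sum has_derivative_dderiv assms)

lemma differentiable_sum_fun:
  fixes f :: "'i \<Rightarrow> real \<times> real \<Rightarrow> complex"
  assumes "\<And>i. i \<in> A \<Longrightarrow> f i differentiable (at p)"
  shows "(\<lambda>q. \<Sum>i\<in>A. f i q) differentiable (at p)"
  by (rule differentiableI[OF has_derivative_sum[OF has_derivative_dderiv[OF assms]]])

lemma dderiv_inverse:
  fixes f :: "real \<times> real \<Rightarrow> complex"
  assumes "f differentiable (at p)" "f p \<noteq> 0"
  shows "dderiv e (\<lambda>q. inverse (f q)) p = - (dderiv e f p * (inverse (f p) * inverse (f p)))"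
  using dderivI[OF Deriv.has_derivative_inverse[OF assms(2) has_derivative_dderiv[OF assms(1)]]]
  by (simp add: ac_simps)

text \<open>Many identities below hold only where \<open>B\<close> and \<open>M\<close> are
  invertible. Since that set is open, they may still be differentiated there.\<close>

lemma has_derivative_cong_open:
  assumes "open S" "p \<in> S" "\<And>q. q \<in> S \<Longrightarrow> f q = g q"
  shows "(f has_derivative f') (at p) \<longleftrightarrow> (g has_derivative f') (at p)"
proof
  show "(f has_derivative f') (at p) \<Longrightarrow> (g has_derivative f') (at p)"
    by (erule has_derivative_transform_within_open[OF _ assms(1,2)]) (rule assms(3))
  show "(g has_derivative f') (at p) \<Longrightarrow> (f has_derivative f') (at p)"
    by (erule has_derivative_transform_within_open[OF _ assms(1,2)]) (rule assms(3)[symmetric])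
qed

lemma dderiv_cong_open:
  assumes "open S" "p \<in> S" "\<And>q. q \<in> S \<Longrightarrow> f q = g q"
  shows "dderiv e f p = dderiv e g p"
  unfolding dderiv_def frechet_derivative_def
  by (simp only: has_derivative_cong_open[of S p f g, OF assms])

lemma differentiable_cong_open:
  assumes "open S" "p \<in> S" "\<And>q. q \<in> S \<Longrightarrow> f q = g q" "f differentiable (at p)"
  shows "g differentiable (at p)"
  using assms(4) unfolding differentiable_def
  by (simp only: has_derivative_cong_open[of S p f g, OF assms(1-3)])

lemma differentiable_vec_nth:
  fixes f :: "real \<times> real \<Rightarrow> ('a::real_normed_vector)^'m"
  assumes "f differentiable (at p)"
  shows "(\<lambda>q. f q $ k) differentiable (at p)"
  by (rule differentiableI[OF bounded_linear.has_derivative[OF bounded_linear_vec_nth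
        has_derivative_dderiv[OF assms]]])

lemma differentiable_vecI:
  fixes f :: "real \<times> real \<Rightarrow> ('a::euclidean_space)^'m"
  assumes *: "\<And>k. (\<lambda>q. f q $ k) differentiable (at p)"
  shows "f differentiable (at p)"
proof -
  have "(\<lambda>q. f q \<bullet> b) differentiable (at p)" if b: "b \<in> Basis" for b :: "'a^'m"
  proof -
    obtain k u where b: "b = axis k u"
      using b unfolding Basis_vec_def by blast
    have "(\<lambda>q. f q $ k \<bullet> u) differentiable (at p)"
      by (rule differentiable_inner[OF * differentiable_const])
    then show ?thesis unfolding b inner_axis .
  qed
  then show ?thesis using differentiable_componentwise_within by blast
qed

lemma dderiv_vec_nth:
  fixes f :: "real \<times> real \<Rightarrow> ('a::real_normed_vector)^'m"
  assumes "f differentiable (at p)"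
  shows "dderiv e f p $ k = dderiv e (\<lambda>q. f q $ k) p"
  by (simp only: dderivI[OF bounded_linear.has_derivative[OF bounded_linear_vec_nth
        has_derivative_dderiv[OF assms]]])

text \<open>Differentiability is not assumed: the restrictions to the line through \<open>p\<close>
  agree near its base point, so the total operator \<open>vector_derivative\<close> returns the same
  value for both.\<close>

lemma dx_cong_open:
  assumes "open S" "p \<in> S" "\<And>q. q \<in> S \<Longrightarrow> f q = g q"
  shows "dx f p = dx g p"
proof -
  have "open ((\<lambda>s. (s, snd p)) -` S)"
    using assms(1) by (intro open_vimage) (auto intro!: continuous_intros)
  then have "\<forall>\<^sub>F s in nhds (fst p). s \<in> (\<lambda>s. (s, snd p)) -` S"
    using assms(2) by (intro eventually_nhds_in_open) auto
  then have "\<forall>\<^sub>F s in nhds (fst p). f (s, snd p) = g (s, snd p)"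
    by eventually_elim (use assms(3) in auto)
  then show ?thesis unfolding dx_def
    by (intro vector_derivative_cong_eq) auto
qed

lemma dt_cong_open:
  assumes "open S" "p \<in> S" "\<And>q. q \<in> S \<Longrightarrow> f q = g q"
  shows "dt f p = dt g p"
proof -
  have "open ((\<lambda>s. (fst p, s)) -` S)"
    using assms(1) by (intro open_vimage) (auto intro!: continuous_intros)
  then have "\<forall>\<^sub>F s in nhds (snd p). s \<in> (\<lambda>s. (fst p, s)) -` S"
    using assms(2) by (intro eventually_nhds_in_open) auto
  then have "\<forall>\<^sub>F s in nhds (snd p). f (fst p, s) = g (fst p, s)"
    by eventually_elim (use assms(3) in auto)
  then show ?thesis unfolding dt_def
    by (intro vector_derivative_cong_eq) auto
qed

section \<open>Closure properties of the classes C^k and of smooth functions\<close>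

lemma Ck_on_cong:
  assumes "open S" "\<And>q. q \<in> S \<Longrightarrow> f q = g q" "Ck_on k S f"
  shows "Ck_on k S g"
  using assms(2,3)
proof (induction k arbitrary: f g)
  case 0
  then show ?case using continuous_on_cong[of S S f g] by simp
next
  case (Suc k)
  have "Ck_on k S (dx g)"
    by (rule Suc.IH[of "dx f"])
      (use Suc.prems in \<open>auto simp: Ck_on.simps(2) intro: dx_cong_open[OF assms(1)]\<close>)
  moreover have "Ck_on k S (dt g)"
    by (rule Suc.IH[of "dt f"])
      (use Suc.prems in \<open>auto simp: Ck_on.simps(2) intro: dt_cong_open[OF assms(1)]\<close>)
  moreover have "g differentiable (at q)" if "q \<in> S" for q
    by (rule differentiable_cong_open[OF assms(1) that Suc.prems(1)])
      (use Suc.prems that in \<open>auto simp: Ck_on.simps(2)\<close>)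
  ultimately show ?case by (simp add: Ck_on.simps(2))
qed

text \<open>\<open>dx f\<close> and \<open>dderiv (1, 0) f\<close> are only known to agree on
  \<open>S\<close>, so the exchange rests on the locality of C^k on open sets.\<close>

lemma Ck_on_Suc_iff:
  assumes "open S"
  shows "Ck_on (Suc k) S f \<longleftrightarrow> (\<forall>p\<in>S. f differentiable (at p)) \<and>
    Ck_on k S (dderiv (1, 0) f) \<and> Ck_on k S (dderiv (0, 1) f)"
  using Ck_on_cong[OF assms, of "dx f" "dderiv (1, 0) f"] Ck_on_cong[OF assms, of "dderiv (1, 0) f" "dx f"]
    Ck_on_cong[OF assms, of "dt f" "dderiv (0, 1) f"] Ck_on_cong[OF assms, of "dderiv (0, 1) f" "dt f"]
  by (auto simp: dx_eq_dderiv dt_eq_dderiv)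

declare Ck_on.simps(2) [simp del]

lemma Ck_on_subset: "Ck_on k S f \<Longrightarrow> S' \<subseteq> S \<Longrightarrow> Ck_on k S' f"
  by (induction k arbitrary: f) (auto simp: Ck_on.simps(2) intro: continuous_on_subset)

lemma Ck_on_Suc_imp: "Ck_on (Suc k) S f \<Longrightarrow> Ck_on k S f"
proof (induction k arbitrary: f)
  case 0
  then show ?case
    by (auto simp: Ck_on.simps(2)
        intro!: continuous_at_imp_continuous_on differentiable_imp_continuous_within)
next
  case (Suc k)
  then show ?case by (metis Ck_on.simps(2))
qed

lemma Ck_on_const: "Ck_on k S (\<lambda>q. c)"
proof (induction k arbitrary: c)
  case (Suc k)
  have "dx (\<lambda>q. c) = (\<lambda>q. 0)" "dt (\<lambda>q. c) = (\<lambda>q. 0)"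
    by (auto simp: fun_eq_iff dx_def dt_def)
  then show ?case using Suc by (simp add: Ck_on.simps(2))
qed auto

context
  fixes S :: "(real \<times> real) set"
  assumes S: "open S"
begin

lemma Ck_on_SucI:
  assumes "\<And>p. p \<in> S \<Longrightarrow> f differentiable (at p)"
    and "\<And>e. e = (1, 0) \<or> e = (0, 1) \<Longrightarrow> Ck_on k S (dderiv e f)"
  shows "Ck_on (Suc k) S f"
  unfolding Ck_on_Suc_iff[OF S] using assms by blast

lemma Ck_on_SucD:
  assumes "Ck_on (Suc k) S f"
  shows "p \<in> S \<Longrightarrow> f differentiable (at p)"
    and "e = (1, 0) \<or> e = (0, 1) \<Longrightarrow> Ck_on k S (dderiv e f)"
  using assms unfolding Ck_on_Suc_iff[OF S] by blast+

lemma Ck_on_add: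
  fixes f g :: "real \<times> real \<Rightarrow> complex"
  shows "Ck_on k S f \<Longrightarrow> Ck_on k S g \<Longrightarrow> Ck_on k S (\<lambda>q. f q + g q)"
proof (induction k arbitrary: f g)
  case 0
  then show ?case unfolding Ck_on.simps(1) by (rule continuous_on_add)
next
  case (Suc k)
  note f = Ck_on_SucD[OF Suc.prems(1)] and g = Ck_on_SucD[OF Suc.prems(2)]
  show ?case
  proof (rule Ck_on_SucI)
    show "(\<lambda>q. f q + g q) differentiable (at p)" if "p \<in> S" for p
      using f(1)[OF that] g(1)[OF that] by (rule differentiable_add)
    show "Ck_on k S (dderiv e (\<lambda>q. f q + g q))" if "e = (1, 0) \<or> e = (0, 1)" for e
      by (rule Ck_on_cong[OF S dderiv_add[symmetric] Suc.IH]) (use f g that in blast)+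
  qed
qed

lemma Ck_on_mult:
  fixes f g :: "real \<times> real \<Rightarrow> complex"
  shows "Ck_on k S f \<Longrightarrow> Ck_on k S g \<Longrightarrow> Ck_on k S (\<lambda>q. f q * g q)"
proof (induction k arbitrary: f g)
  case 0
  then show ?case unfolding Ck_on.simps(1) by (rule continuous_on_mult)
next
  case (Suc k)
  note f = Ck_on_SucD[OF Suc.prems(1)] and g = Ck_on_SucD[OF Suc.prems(2)]
  \<comment> \<open>The product rule also contains the undifferentiated factors, which must
    therefore be of class C^k themselves.\<close>
  note IH = Suc.IH Suc.prems[THEN Ck_on_Suc_imp]
  show ?case
  proof (rule Ck_on_SucI)
    show "(\<lambda>q. f q * g q) differentiable (at p)" if "p \<in> S" for p
      using f(1)[OF that] g(1)[OF that] by (rule differentiable_mult)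
    show "Ck_on k S (dderiv e (\<lambda>q. f q * g q))" if "e = (1, 0) \<or> e = (0, 1)" for e
      by (rule Ck_on_cong[OF S dderiv_mult[symmetric] Ck_on_add]) (use f g IH that in blast)+
  qed
qed

lemma Ck_on_cnj:
  fixes f :: "real \<times> real \<Rightarrow> complex"
  shows "Ck_on k S f \<Longrightarrow> Ck_on k S (\<lambda>q. cnj (f q))"
proof (induction k arbitrary: f)
  case 0
  then show ?case unfolding Ck_on.simps(1) by (rule continuous_on_cnj)
next
  case (Suc k)
  note f = Ck_on_SucD[OF Suc.prems(1)]
  show ?case
  proof (rule Ck_on_SucI)
    show "(\<lambda>q. cnj (f q)) differentiable (at p)" if "p \<in> S" for p
      using f(1)[OF that] by (rule differentiable_cnj)
    show "Ck_on k S (dderiv e (\<lambda>q. cnj (f q)))" if "e = (1, 0) \<or> e = (0, 1)" for e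
      by (rule Ck_on_cong[OF S dderiv_cnj[symmetric] Suc.IH]) (use f that in blast)+
  qed
qed

text \<open>The derivative of 1/f is built from the derivative of f and from 1/f itself, so the
  induction on \<open>k\<close> closes with \<open>f\<close> fixed.\<close>

lemma Ck_on_inverse:
  fixes f :: "real \<times> real \<Rightarrow> complex"
  assumes nz: "\<And>q. q \<in> S \<Longrightarrow> f q \<noteq> 0"
  shows "Ck_on k S f \<Longrightarrow> Ck_on k S (\<lambda>q. inverse (f q))"
proof (induction k)
  case 0
  have "continuous_on S f" using 0 by (simp only: Ck_on.simps(1))
  then have "continuous_on S (\<lambda>q. inverse (f q))"
    by (rule continuous_on_inverse) (rule ballI, rule nz)
  then show ?case by (simp only: Ck_on.simps(1))
next
  case (Suc k)
  note f = Ck_on_SucD[OF Suc.prems]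
  have IH: "Ck_on k S (\<lambda>q. inverse (f q))" by (rule Suc.IH[OF Ck_on_Suc_imp[OF Suc.prems]])
  show ?case
  proof (rule Ck_on_SucI)
    show "(\<lambda>q. inverse (f q)) differentiable (at p)" if "p \<in> S" for p
      using f(1)[OF that] nz[OF that] by (rule differentiable_inverse)
    show "Ck_on k S (dderiv e (\<lambda>q. inverse (f q)))" if e: "e = (1, 0) \<or> e = (0, 1)" for e
    proof (rule Ck_on_cong[OF S])
      show "Ck_on k S (\<lambda>q. (- 1) * (dderiv e f q * (inverse (f q) * inverse (f q))))"
        by (intro Ck_on_mult Ck_on_const IH f(2) e)
      show "(- 1) * (dderiv e f q * (inverse (f q) * inverse (f q))) = dderiv e (\<lambda>q. inverse (f q)) q"
        if "q \<in> S" for q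
        unfolding dderiv_inverse[OF f(1)[OF that] nz[OF that]] by simp
    qed
  qed
qed

end

lemma smooth_on_differentiable: "smooth_on S f \<Longrightarrow> p \<in> S \<Longrightarrow> f differentiable (at p)"
  unfolding smooth_on_def using Ck_on.simps(2)[of 0 S f] by blast

lemma smooth_on_dderiv:
  assumes "open S" "smooth_on S f" "e = (1, 0) \<or> e = (0, 1)"
  shows "smooth_on S (dderiv e f)"
  using assms Ck_on_Suc_iff[OF assms(1)] unfolding smooth_on_def by blast

lemma smooth_on_cong:
  "open S \<Longrightarrow> (\<And>q. q \<in> S \<Longrightarrow> f q = g q) \<Longrightarrow> smooth_on S f \<Longrightarrow> smooth_on S g"
  unfolding smooth_on_def using Ck_on_cong by blast

lemma smooth_on_subset: "smooth_on S f \<Longrightarrow> S' \<subseteq> S \<Longrightarrow> smooth_on S' f"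
  unfolding smooth_on_def using Ck_on_subset by blast

lemma smooth_on_const: "smooth_on S (\<lambda>q. c)"
  unfolding smooth_on_def using Ck_on_const by blast

context
  fixes S :: "(real \<times> real) set"
  assumes S: "open S"
begin

lemma smooth_on_add:
  fixes f g :: "real \<times> real \<Rightarrow> complex"
  shows "smooth_on S f \<Longrightarrow> smooth_on S g \<Longrightarrow> smooth_on S (\<lambda>q. f q + g q)"
  unfolding smooth_on_def using Ck_on_add[OF S] by blast

lemma smooth_on_mult:
  fixes f g :: "real \<times> real \<Rightarrow> complex"
  shows "smooth_on S f \<Longrightarrow> smooth_on S g \<Longrightarrow> smooth_on S (\<lambda>q. f q * g q)"
  unfolding smooth_on_def using Ck_on_mult[OF S] by blast

lemma smooth_on_cnj:
  fixes f :: "real \<times> real \<Rightarrow> complex"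
  shows "smooth_on S f \<Longrightarrow> smooth_on S (\<lambda>q. cnj (f q))"
  unfolding smooth_on_def using Ck_on_cnj[OF S] by blast

lemma smooth_on_diff:
  fixes f g :: "real \<times> real \<Rightarrow> complex"
  assumes "smooth_on S f" "smooth_on S g"
  shows "smooth_on S (\<lambda>q. f q - g q)"
  using smooth_on_add[OF assms(1) smooth_on_mult[OF smooth_on_const[of S "- 1"] assms(2)]]
  by simp

lemma smooth_on_divide:
  fixes f g :: "real \<times> real \<Rightarrow> complex"
  assumes "smooth_on S f" "smooth_on S g" "\<And>q. q \<in> S \<Longrightarrow> g q \<noteq> 0"
  shows "smooth_on S (\<lambda>q. f q / g q)"
proof -
  have "smooth_on S (\<lambda>q. inverse (g q))"
    unfolding smooth_on_def
    by (intro allI Ck_on_inverse[OF S, of g] assms(3))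
      (use assms(2) in \<open>simp_all add: smooth_on_def\<close>)
  then show ?thesis unfolding divide_inverse by (rule smooth_on_mult[OF assms(1)])
qed

lemma smooth_on_sum:
  fixes f :: "'i \<Rightarrow> real \<times> real \<Rightarrow> complex"
  shows "(\<And>i. i \<in> A \<Longrightarrow> smooth_on S (f i)) \<Longrightarrow> smooth_on S (\<lambda>q. \<Sum>i\<in>A. f i q)"
  by (induction A rule: infinite_finite_induct) (auto intro: smooth_on_add smooth_on_const)

lemma smooth_on_prod:
  fixes f :: "'i \<Rightarrow> real \<times> real \<Rightarrow> complex"
  shows "(\<And>i. i \<in> A \<Longrightarrow> smooth_on S (f i)) \<Longrightarrow> smooth_on S (\<lambda>q. \<Prod>i\<in>A. f i q)"
  by (induction A rule: infinite_finite_induct) (auto intro: smooth_on_mult smooth_on_const)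

lemma smooth_on_det:
  fixes A :: "real \<times> real \<Rightarrow> complex^'n^'n"
  assumes "\<And>i j. smooth_on S (\<lambda>q. A q $ i $ j)"
  shows "smooth_on S (\<lambda>q. det (A q))"
  unfolding det_def by (intro smooth_on_sum smooth_on_mult smooth_on_prod smooth_on_const assms)

end

section \<open>Equality of mixed partial derivatives\<close>

text \<open>The mean value theorem is applied twice to the second difference over a square of side
  \<open>h\<close>: first in the first variable to the difference of two slices, then in the second
  variable to \<open>fx\<close>.\<close>

lemma second_difference_mvt:
  fixes f fx fxt :: "real \<times> real \<Rightarrow> real"
  assumes h: "h > 0"
    and fx: "\<And>a b. x \<le> a \<Longrightarrow> a \<le> x + h \<Longrightarrow> t \<le> b \<Longrightarrow> b \<le> t + h \<Longrightarrow>
      ((\<lambda>s. f (s, b)) has_real_derivative fx (a, b)) (at a)"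
    and fxt: "\<And>a b. x \<le> a \<Longrightarrow> a \<le> x + h \<Longrightarrow> t \<le> b \<Longrightarrow> b \<le> t + h \<Longrightarrow>
      ((\<lambda>s. fx (a, s)) has_real_derivative fxt (a, b)) (at b)"
  shows "\<exists>a b. x \<le> a \<and> a \<le> x + h \<and> t \<le> b \<and> b \<le> t + h \<and>
    f (x + h, t + h) - f (x + h, t) - f (x, t + h) + f (x, t) = h * h * fxt (a, b)"
proof -
  have "\<exists>a>x. a < x + h \<and> (\<lambda>s. f (s, t + h) - f (s, t)) (x + h) - (\<lambda>s. f (s, t + h) - f (s, t)) x
      = (x + h - x) * (fx (a, t + h) - fx (a, t))"
    using h by (intro MVT2) (auto intro!: derivative_intros fx)
  then obtain a where a: "x < a" "a < x + h"
    "f (x + h, t + h) - f (x + h, t) - f (x, t + h) + f (x, t) = h * (fx (a, t + h) - fx (a, t))"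
    by auto
  have "\<exists>b>t. b < t + h \<and> (\<lambda>s. fx (a, s)) (t + h) - (\<lambda>s. fx (a, s)) t = (t + h - t) * fxt (a, b)"
    using h a by (intro MVT2) (auto intro!: fxt)
  then obtain b where "t < b" "b < t + h" "fx (a, t + h) - fx (a, t) = h * fxt (a, b)" by auto
  with a show ?thesis by (intro exI[of _ a] exI[of _ b]) auto
qed

text \<open>Schwarz's theorem: the second difference is symmetric in the two variables, so on every
  small square the two mixed partials share a value, possibly at different points. Continuity
  carries this to the limit \<open>p\<close>.\<close>

lemma mixed_partials_eq_real:
  fixes f fx ft fxt ftx :: "real \<times> real \<Rightarrow> real"
  assumes S: "open S" "p \<in> S"
    and fx: "\<And>a b. (a, b) \<in> S \<Longrightarrow> ((\<lambda>s. f (s, b)) has_real_derivative fx (a, b)) (at a)"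
    and ft: "\<And>a b. (a, b) \<in> S \<Longrightarrow> ((\<lambda>s. f (a, s)) has_real_derivative ft (a, b)) (at b)"
    and fxt: "\<And>a b. (a, b) \<in> S \<Longrightarrow> ((\<lambda>s. fx (a, s)) has_real_derivative fxt (a, b)) (at b)"
    and ftx: "\<And>a b. (a, b) \<in> S \<Longrightarrow> ((\<lambda>s. ft (s, b)) has_real_derivative ftx (a, b)) (at a)"
    and cont: "continuous_on S fxt" "continuous_on S ftx"
  shows "fxt p = ftx p"
proof (rule ccontr)
  assume ne: "fxt p \<noteq> ftx p"
  define \<epsilon> where "\<epsilon> = \<bar>fxt p - ftx p\<bar> / 2"
  have \<epsilon>: "\<epsilon> > 0" using ne by (simp add: \<epsilon>_def)
  obtain x t where p: "p = (x, t)" by (cases p)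
  obtain d where d: "d > 0" "\<And>q. dist q p < d \<Longrightarrow> q \<in> S"
    using S by (auto simp: open_dist)
  have "isCont fxt p" "isCont ftx p"
    using cont S continuous_on_eq_continuous_at by blast+
  then obtain d1 d2 where d12: "d1 > 0" "\<And>q. dist q p < d1 \<Longrightarrow> dist (fxt q) (fxt p) < \<epsilon>"
      "d2 > 0" "\<And>q. dist q p < d2 \<Longrightarrow> dist (ftx q) (ftx p) < \<epsilon>"
    using \<epsilon> unfolding continuous_at_eps_delta dist_norm by metis
  \<comment> \<open>Points of the square lie within \<open>2 * h\<close> of \<open>p\<close>, hence
    strictly inside all three radii.\<close>
  define h where "h = Min {d, d1, d2} / 3"
  have h: "h > 0" "3 * h \<le> d" "3 * h \<le> d1" "3 * h \<le> d2"
    using d d12 by (auto simp: h_def)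
  have near: "dist (a, b) p < 3 * h" if "x \<le> a" "a \<le> x + h" "t \<le> b" "b \<le> t + h" for a b
  proof -
    have "dist (a, b) p \<le> dist a x + dist b t"
      unfolding p dist_prod_def by (simp add: sqrt_sum_squares_le_sum)
    also have "\<dots> \<le> h + h" using that by (intro add_mono) (auto simp: dist_real_def)
    finally show ?thesis using h by linarith
  qed
  have inS: "(a, b) \<in> S" if "x \<le> a" "a \<le> x + h" "t \<le> b" "b \<le> t + h" for a b
    using near[OF that] d h by force
  obtain a b where 1: "x \<le> a" "a \<le> x + h" "t \<le> b" "b \<le> t + h"
    "f (x + h, t + h) - f (x + h, t) - f (x, t + h) + f (x, t) = h * h * fxt (a, b)"
    using second_difference_mvt[of h x t f fx fxt] h fx fxt inS by blast
  \<comment> \<open>The same lemma with the two variables exchanged; the left-hand side is the same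
    second difference up to reordering.\<close>
  obtain b' a' where 2: "t \<le> b'" "b' \<le> t + h" "x \<le> a'" "a' \<le> x + h"
    "f (x + h, t + h) - f (x, t + h) - f (x + h, t) + f (x, t) = h * h * ftx (a', b')"
    using second_difference_mvt[of h t x "\<lambda>(b, a). f (a, b)" "\<lambda>(b, a). ft (a, b)" "\<lambda>(b, a). ftx (a, b)"]
      h ft ftx inS by auto
  have "h * h * fxt (a, b) = h * h * ftx (a', b')"
    using 1(5) 2(5) by linarith
  then have "fxt (a, b) = ftx (a', b')" using h by simp
  moreover have "dist (fxt (a, b)) (fxt p) < \<epsilon>" using near[OF 1(1-4)] h d12 by force
  moreover have "dist (ftx (a', b')) (ftx p) < \<epsilon>" using near[OF 2(3,4,1,2)] h d12 by force
  ultimately show False unfolding \<epsilon>_def dist_real_def by (simp add: abs_if field_simps split: if_splits)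
qed

lemma mixed_partials_eq:
  fixes f :: "real \<times> real \<Rightarrow> complex"
  assumes S: "open S" "p \<in> S" and f: "smooth_on S f"
  shows "dderiv (0, 1) (dderiv (1, 0) f) p = dderiv (1, 0) (dderiv (0, 1) f) p"
proof -
  note sm = f smooth_on_dderiv[OF S(1) f] smooth_on_dderiv[OF S(1) smooth_on_dderiv[OF S(1) f]]
  \<comment> \<open>The mean value theorem needs real values. Here \<open>moment\<close> is an
    arbitrary bounded real functional, later instantiated with \<open>Re\<close> and
    \<open>Im\<close>.\<close>
  have key: "moment (dderiv (0, 1) (dderiv (1, 0) f) p) = moment (dderiv (1, 0) (dderiv (0, 1) f) p)"
    if moment: "bounded_linear moment" for moment :: "complex \<Rightarrow> real"
  proof -
    have 1: "((\<lambda>s. moment (g (s, b))) has_real_derivative moment (dderiv (1, 0) g (a, b))) (at a)"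
      if "(a, b) \<in> S" "smooth_on S g" for a b g
      using bounded_linear.has_vector_derivative[OF moment has_vector_derivative_slice_x[OF
          smooth_on_differentiable[OF that(2,1)]]]
      by (simp add: has_real_derivative_iff_has_vector_derivative)
    have 2: "((\<lambda>s. moment (g (a, s))) has_real_derivative moment (dderiv (0, 1) g (a, b))) (at b)"
      if "(a, b) \<in> S" "smooth_on S g" for a b g
      using bounded_linear.has_vector_derivative[OF moment has_vector_derivative_slice_t[OF
          smooth_on_differentiable[OF that(2,1)]]]
      by (simp add: has_real_derivative_iff_has_vector_derivative)
    have 3: "continuous_on S (\<lambda>q. moment (g q))" if "smooth_on S g" for g
      using that[unfolded smooth_on_def, rule_format, of 0]
      by (auto intro!: bounded_linear.continuous_on[OF moment])
    show ?thesis
      by (rule mixed_partials_eq_real[OF S, of "\<lambda>q. moment (f q)"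
            "\<lambda>q. moment (dderiv (1, 0) f q)" "\<lambda>q. moment (dderiv (0, 1) f q)"])
        (intro 1 2 3 sm; simp)+
  qed
  show ?thesis using key[OF bounded_linear_Re] key[OF bounded_linear_Im] by (simp add: complex_eq_iff)
qed

text \<open>The equation is written with \<open>dt (dx u)\<close>, whereas for the dressed potential
  the t-derivative is found first and then differentiated in x.\<close>

lemma dt_dx_eq:
  fixes f :: "real \<times> real \<Rightarrow> complex"
  assumes S: "open S" "p \<in> S" and f: "smooth_on S f"
  shows "dt (dx f) p = dderiv (1, 0) (dderiv (0, 1) f) p"
proof -
  have "dt (dx f) p = dt (dderiv (1, 0) f) p"
    by (rule dt_cong_open[OF S]) (rule dx_eq_dderiv[OF smooth_on_differentiable[OF f]])
  also have "\<dots> = dderiv (0, 1) (dderiv (1, 0) f) p"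
    by (rule dt_eq_dderiv[OF smooth_on_differentiable[OF smooth_on_dderiv[OF S(1) f] S(2)]]) simp
  also have "\<dots> = dderiv (1, 0) (dderiv (0, 1) f) p"
    by (rule mixed_partials_eq[OF S f])
  finally show ?thesis .
qed

section \<open>Pointwise algebra of the dressing matrix\<close>

text \<open>One summand of the x-identity in component k. \<open>s\<close> is the sign of
  \<open>sigma3\<close> there, \<open>X\<close> and \<open>X'\<close> are that component of x_i and
  its derivative, and \<open>P\<close> is that of Q[N]_x x_i. \<open>g\<close> and \<open>h\<close>
  pair y_i with \<Phi> through J and J sigma3, \<open>q\<close> and \<open>r\<close> pair it with
  Q_x \<Phi>, and \<open>g0\<close> and \<open>h0\<close> pair the derivative of y_i with
  \<Phi>.\<close>

lemma dressing_x_term: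
  fixes z a s X X' P g h q r :: complex
  assumes s: "s = 1 \<or> s = -1" and nz: "z \<noteq> 0" "a \<noteq> 0" "z - a \<noteq> 0" "z + a \<noteq> 0"
    and g0: "g0 = - (\<i> / a\<^sup>2 * h + q / a)" and h0: "h0 = - (\<i> / a\<^sup>2 * g - r / a)"
  shows "X' * (g / (z - a) - s * h / (z + a))
      + X * ((g0 + (\<i> / z\<^sup>2 * h + q / z)) / (z - a) - s * (h0 + (\<i> / z\<^sup>2 * g + r / z)) / (z + a))
      - \<i> * s / z\<^sup>2 * (X * (g / (z - a) - s * h / (z + a)))
      - (X' * (g - s * h) + X * (g0 - s * h0) + P * (g / (z - a) + s * h / (z + a))) / z
    = a / z * ((X' - (\<i> * s / a\<^sup>2 * X + P / a)) * (g / (z - a) + s * h / (z + a)))"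
proof -
  \<comment> \<open>Treating the reciprocals as atoms with the relations \<open>e\<close> turns the
    claim into a polynomial ideal membership.\<close>
  define u v w b where "u = 1 / (z - a)" and "v = 1 / (z + a)" and "w = 1 / z" and "b = 1 / a"
  have e: "u * (z - a) = 1" "v * (z + a) = 1" "w * z = 1" "b * a = 1" "s * s = 1"
    using nz s by (auto simp: u_def v_def w_def b_def)
  have d: "y / (z - a) = y * u" "y / (z + a) = y * v" "y / z = y * w" "y / a = y * b"
    "y / z\<^sup>2 = y * w * w" "y / a\<^sup>2 = y * b * b" for y
    by (auto simp: u_def v_def w_def b_def power2_eq_square)
  show ?thesis unfolding g0 h0 d using e by algebra
qed

text \<open>The t-analogue: \<open>q\<close>, \<open>r\<close>, \<open>P\<close> now involve Q and
  Q[N] themselves, while \<open>q2\<close>, \<open>r2\<close>, \<open>P2\<close> involve their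
  squares.\<close>

lemma dressing_t_term:
  fixes z a s X X' P P2 g h q r q2 r2 :: complex
  assumes s: "s = 1 \<or> s = -1" and nz: "z - a \<noteq> 0" "z + a \<noteq> 0"
    and g0: "g0 = - \<i> * (a\<^sup>2 / 4 * h + r2 / 2 - a / 2 * r)"
    and h0: "h0 = - \<i> * (a\<^sup>2 / 4 * g + q2 / 2 + a / 2 * q)"
  shows "X' * (g / (z - a) - s * h / (z + a))
      + X * ((g0 + \<i> * (z\<^sup>2 / 4 * h + r2 / 2 - z / 2 * r)) / (z - a)
           - s * (h0 + \<i> * (z\<^sup>2 / 4 * g + q2 / 2 - z / 2 * q)) / (z + a))
      - \<i> * s * (z\<^sup>2 / 4 * (X * (g / (z - a) - s * h / (z + a)))
          + (P * (g + s * h) + X * (q - s * r) + P2 * (g / (z - a) - s * h / (z + a))) / 2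
          - z / 2 * (X * (g - s * h) + P * (g / (z - a) + s * h / (z + a))))
    = (X' - \<i> * s * (a\<^sup>2 / 4 * X + P2 / 2 - a / 2 * P)) * (g / (z - a) - s * h / (z + a))"
proof -
  define u v where "u = 1 / (z - a)" and "v = 1 / (z + a)"
  have e: "u * (z - a) = 1" "v * (z + a) = 1" "s * s = 1"
    using nz s by (auto simp: u_def v_def)
  have d: "y / (z - a) = y * u" "y / (z + a) = y * v" for y
    by (auto simp: u_def v_def)
  \<comment> \<open>The bracket vanishes at \<open>z = a\<close>, because it is the difference of
    one quadratic polynomial at \<open>z\<close> and at \<open>a\<close>. The pole therefore
    cancels; in \<open>H\<close> the same happens at \<open>z = - a\<close>.\<close>
  have G: "(g0 + \<i> * (z\<^sup>2 / 4 * h + r2 / 2 - z / 2 * r)) * u = \<i> * ((z + a) / 4 * h - r / 2)"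
  proof -
    have "g0 + \<i> * (z\<^sup>2 / 4 * h + r2 / 2 - z / 2 * r) = (z - a) * (\<i> * ((z + a) / 4 * h - r / 2))"
      unfolding g0 by (simp add: field_simps power2_eq_square)
    then show ?thesis using e by (simp add: mult.assoc mult.commute[of _ u])
  qed
  have H: "s * (h0 + \<i> * (z\<^sup>2 / 4 * g + q2 / 2 - z / 2 * q)) * v = s * (\<i> * ((z - a) / 4 * g - q / 2))"
  proof -
    have "h0 + \<i> * (z\<^sup>2 / 4 * g + q2 / 2 - z / 2 * q) = (z + a) * (\<i> * ((z - a) / 4 * g - q / 2))"
      unfolding h0 by (simp add: field_simps power2_eq_square)
    then show ?thesis using e by (simp add: mult.assoc mult.commute[of _ v])
  qed
  \<comment> \<open>One half becomes an atom with \<open>k * 2 = 1\<close>, which again leaves a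
    polynomial identity.\<close>
  define k where "k = (1/2 :: complex)"
  have k: "y / 4 = y * (k * k)" "y / 2 = y * k" "k * 2 = 1" for y by (auto simp: k_def)
  show ?thesis unfolding d G H unfolding k(1,2) using e k(3) by algebra
qed

section \<open>The forms given by J and J sigma3, and the action of the dressing matrices on
  vectors\<close>

definition sgn3 :: "3 \<Rightarrow> complex" where "sgn3 k = (if k = 1 then 1 else -1)"

definition bra_J :: "complex \<Rightarrow> complex^3 \<Rightarrow> complex^3 \<Rightarrow> complex" where
  "bra_J \<sigma> y v = braket y (Jmat \<sigma>) v"

definition bra_J3 :: "complex \<Rightarrow> complex^3 \<Rightarrow> complex^3 \<Rightarrow> complex" where
  "bra_J3 \<sigma> y v = braket y (Jmat \<sigma> ** sigma3) v"

lemma sgn3_cases: "sgn3 k = 1 \<or> sgn3 k = -1" by (simp add: sgn3_def)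

lemma sgn3_simps [simp]: "sgn3 1 = 1" "sgn3 2 = -1" "sgn3 3 = -1"
  by (simp_all add: sgn3_def)

lemma mat_mult_nth: "(mat c ** A) $ k $ l = c * (A :: complex^'m^'n) $ k $ l"
  by (simp add: matrix_matrix_mult_def mat_def if_distrib if_distribR cong: if_cong)

lemma mat_mult_vec: "(mat c ** A) *v v = c *s (A *v (v :: complex^'m))"
  by (simp add: vec_eq_iff matrix_vector_mult_def mat_mult_nth sum_distrib_left mult.assoc)

lemma mat_vec: "mat c *v v = c *s (v :: complex^'m)"
  using mat_mult_vec[of c "mat 1" v] by simp

lemma sigma3_vec: "(sigma3 *v v) $ k = sgn3 k * v $ k"
  using exhaust_3[of k] by (auto simp: matrix_vector_mult_def sigma3_def sum_3 vector_3)

lemma Qmat_vec: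
  "(Qmat \<sigma> a b *v v) $ 1 = cnj a * v $ 2 + \<sigma> * cnj b * v $ 3"
  "(Qmat \<sigma> a b *v v) $ 2 = a * v $ 1"
  "(Qmat \<sigma> a b *v v) $ 3 = b * v $ 1"
  by (simp_all add: matrix_vector_mult_def Qmat_def sum_3 vector_3)

text \<open>\<open>Qmat\<close> is off-diagonal for the block splitting 1 + 2, on whose blocks
  \<open>sigma3\<close> is 1 and -1.\<close>

lemma Qmat_sigma3: "Qmat \<sigma> a b *v (sigma3 *v v) = - (sigma3 *v (Qmat \<sigma> a b *v v))"
  by (simp add: vec_eq_iff forall_3 Qmat_vec sigma3_vec)

lemma bra_J_expand: "bra_J \<sigma> y v = cnj (y $ 1) * v $ 1 - cnj (y $ 2) * v $ 2 - \<sigma> * (cnj (y $ 3) * v $ 3)"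
  by (simp add: bra_J_def braket_def matrix_vector_mult_def Jmat_def sum_3 vector_3)

lemma bra_J3_eq_bra_J: "bra_J3 \<sigma> y v = bra_J \<sigma> y (sigma3 *v v)"
  by (simp add: bra_J_def bra_J3_def braket_def matrix_vector_mul_assoc)

lemma bra_J3_expand: "bra_J3 \<sigma> y v = cnj (y $ 1) * v $ 1 + cnj (y $ 2) * v $ 2 + \<sigma> * (cnj (y $ 3) * v $ 3)"
  by (simp add: bra_J3_eq_bra_J bra_J_expand sigma3_vec)

lemma bra_J_linear:
  "bra_J \<sigma> y (v + w) = bra_J \<sigma> y v + bra_J \<sigma> y w" "bra_J \<sigma> y (v - w) = bra_J \<sigma> y v - bra_J \<sigma> y w"
  "bra_J \<sigma> y (c *s v) = c * bra_J \<sigma> y v" "bra_J \<sigma> y (- v) = - bra_J \<sigma> y v"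
  "bra_J \<sigma> (v + w) y = bra_J \<sigma> v y + bra_J \<sigma> w y" "bra_J \<sigma> (v - w) y = bra_J \<sigma> v y - bra_J \<sigma> w y"
  "bra_J \<sigma> (c *s v) y = cnj c * bra_J \<sigma> v y"
  by (simp_all add: bra_J_expand algebra_simps)

lemma bra_J3_linear:
  "bra_J3 \<sigma> y (v + w) = bra_J3 \<sigma> y v + bra_J3 \<sigma> y w" "bra_J3 \<sigma> y (v - w) = bra_J3 \<sigma> y v - bra_J3 \<sigma> y w"
  "bra_J3 \<sigma> y (c *s v) = c * bra_J3 \<sigma> y v" "bra_J3 \<sigma> y (- v) = - bra_J3 \<sigma> y v"
  "bra_J3 \<sigma> (v + w) y = bra_J3 \<sigma> v y + bra_J3 \<sigma> w y" "bra_J3 \<sigma> (v - w) y = bra_J3 \<sigma> v y - bra_J3 \<sigma> w y"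
  "bra_J3 \<sigma> (c *s v) y = cnj c * bra_J3 \<sigma> v y"
  by (simp_all add: bra_J3_expand algebra_simps)

lemma bra_J_sigma3: "bra_J \<sigma> y (sigma3 *v v) = bra_J3 \<sigma> y v" "bra_J3 \<sigma> y (sigma3 *v v) = bra_J \<sigma> y v"
  "bra_J \<sigma> (sigma3 *v y) v = bra_J3 \<sigma> y v" "bra_J3 \<sigma> (sigma3 *v y) v = bra_J \<sigma> y v"
  by (simp_all add: bra_J3_expand bra_J_expand sigma3_vec)

text \<open>Since \<sigma> is real, the adjoint of Q satisfies Q^* J = - J Q. The extra factor
  \<open>sigma3\<close> anticommutes with Q and reverses the sign. This moves the potential from y_i
  onto the other argument.\<close>

lemma bra_J_Qmat:
  assumes "\<sigma> = 1 \<or> \<sigma> = -1"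
  shows "bra_J \<sigma> (Qmat \<sigma> a b *v y) v = - bra_J \<sigma> y (Qmat \<sigma> a b *v v)"
    and "bra_J3 \<sigma> (Qmat \<sigma> a b *v y) v = bra_J3 \<sigma> y (Qmat \<sigma> a b *v v)"
  using assms by (auto simp: bra_J_expand bra_J3_expand Qmat_vec algebra_simps)

lemma lax_U_vec:
  "lax_U Q z p *v v = (\<i> / z\<^sup>2) *s (sigma3 *v v) + (1 / z) *s (dx Q p *v v)"
  by (simp add: lax_U_def matrix_vector_mult_add_rdistrib mat_mult_vec)

lemma lax_V_vec:
  "lax_V Q z p *v v = \<i> *s (sigma3 *v
     ((z\<^sup>2 / 4) *s v + (1 / 2) *s (Q p *v (Q p *v v)) - (z / 2) *s (Q p *v v)))"
  by (simp add: lax_V_def mat_vec matrix_vector_mult_add_rdistrib matrix_vector_mult_diff_rdistrib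
      matrix_vector_mul_assoc[symmetric] matrix_vector_mult_diff_distrib matrix_vector_right_distrib
      vector_scalar_commute)
    (simp add: vec_eq_iff algebra_simps)

lemma ketbra_vec: "ketbra v w *v u = (\<Sum>k\<in>UNIV. cnj (w $ k) * u $ k) *s v"
  by (simp add: vec_eq_iff ketbra_def matrix_vector_mult_def sum_distrib_left sum_distrib_right algebra_simps)

lemma Amat_vec: "Amat \<sigma> lam y i *v v = bra_J \<sigma> (y i) v *s xvec \<sigma> lam y i"
  by (simp add: Amat_def matrix_vector_mul_assoc[symmetric] ketbra_vec bra_J_def braket_def)

lemma sum_matrix_vec: "(\<Sum>i\<in>I. A i) *v v = (\<Sum>i\<in>I. A i *v (v :: complex^'m))"
  by (induction I rule: infinite_finite_induct) (auto simp: matrix_vector_mult_add_rdistrib)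

lemma matrix_vec_sum: "A *v (\<Sum>i\<in>I. v i) = (\<Sum>i\<in>I. A *v (v i :: complex^'m))"
  by (induction I rule: infinite_finite_induct) (auto simp: matrix_vector_right_distrib)

lemma Tmat_vec:
  "Tmat \<sigma> lam y z *v v = v + (\<Sum>i\<in>UNIV. (bra_J \<sigma> (y i) v / (z - cnj (lam i))) *s xvec \<sigma> lam y i
     - (bra_J3 \<sigma> (y i) v / (z + cnj (lam i))) *s (sigma3 *v xvec \<sigma> lam y i))"
  by (simp add: Tmat_def matrix_vector_mult_add_rdistrib matrix_vector_mult_diff_rdistrib sum_matrix_vec mat_mult_vec
      matrix_vector_mul_assoc[symmetric] Amat_vec bra_J_sigma3 vector_scalar_commute mat_vec)

lemma Tmat_vec_nth:
  "(Tmat \<sigma> lam y z *v v) $ k = v $ k + (\<Sum>i\<in>UNIV. xvec \<sigma> lam y i $ k *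
     (bra_J \<sigma> (y i) v / (z - cnj (lam i)) - sgn3 k * bra_J3 \<sigma> (y i) v / (z + cnj (lam i))))"
  by (simp add: Tmat_vec sigma3_vec algebra_simps)

text \<open>Anticommutation with \<open>sigma3\<close> flips the sign in front of
  \<open>bra_J3\<close> compared with \<open>Tmat_vec_nth\<close>; a second factor
  \<open>Qmat\<close> restores it in the next lemma.\<close>

lemma Qmat_Tmat_vec:
  "(Qmat \<sigma> a b *v (Tmat \<sigma> lam y z *v v)) $ k = (Qmat \<sigma> a b *v v) $ k +
     (\<Sum>i\<in>UNIV. (Qmat \<sigma> a b *v xvec \<sigma> lam y i) $ k *
       (bra_J \<sigma> (y i) v / (z - cnj (lam i)) + sgn3 k * bra_J3 \<sigma> (y i) v / (z + cnj (lam i))))"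
  by (simp add: Tmat_vec matrix_vector_right_distrib matrix_vector_mult_diff_distrib matrix_vec_sum
      vector_scalar_commute Qmat_sigma3 sigma3_vec algebra_simps)

lemma Qmat_Qmat_Tmat_vec:
  "(Qmat \<sigma> a b *v (Qmat \<sigma> a b *v (Tmat \<sigma> lam y z *v v))) $ k = (Qmat \<sigma> a b *v (Qmat \<sigma> a b *v v)) $ k +
     (\<Sum>i\<in>UNIV. (Qmat \<sigma> a b *v (Qmat \<sigma> a b *v xvec \<sigma> lam y i)) $ k *
       (bra_J \<sigma> (y i) v / (z - cnj (lam i)) - sgn3 k * bra_J3 \<sigma> (y i) v / (z + cnj (lam i))))"
proof -
  have "Qmat \<sigma> a b *v (Qmat \<sigma> a b *v (sigma3 *v w)) = sigma3 *v (Qmat \<sigma> a b *v (Qmat \<sigma> a b *v w))" for w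
    by (simp add: vec_eq_iff forall_3 Qmat_vec sigma3_vec algebra_simps)
  then show ?thesis
    by (simp add: Tmat_vec matrix_vector_right_distrib matrix_vector_mult_diff_distrib matrix_vec_sum
      vector_scalar_commute sigma3_vec algebra_simps)
qed

lemma Q_dressed_vec:
  "(Q_dressed \<sigma> lam y q *v v) $ k = (q *v v) $ k +
     (\<Sum>i\<in>UNIV. xvec \<sigma> lam y i $ k * (bra_J \<sigma> (y i) v - sgn3 k * bra_J3 \<sigma> (y i) v))"
  by (simp add: Q_dressed_def matrix_vector_mult_add_rdistrib matrix_vector_mult_diff_rdistrib sum_matrix_vec
      matrix_vector_mul_assoc[symmetric] Amat_vec bra_J_sigma3 sigma3_vec vector_scalar_commute algebra_simps)

section \<open>The linear systems that define the x_i\<close>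

lemma matrix_inv_inverse:
  assumes "invertible A"
  shows "A ** matrix_inv A = mat 1" "matrix_inv A ** A = mat 1"
  using someI_ex[OF assms[unfolded invertible_def]] unfolding matrix_inv_def by auto

lemma vec_mult_matrix_inv:
  fixes A :: "complex^'n^'n"
  assumes "invertible A"
  shows "(\<Sum>i\<in>UNIV. (v v* matrix_inv A) $ i * A $ i $ j) = v $ j"
proof -
  have "(v v* matrix_inv A) v* A = v"
    using assms by (simp add: vector_matrix_mul_assoc matrix_inv_inverse)
  then show ?thesis by (simp add: vec_eq_iff vector_matrix_mult_def mult.commute)
qed

lemma invertible_left_kernel:
  fixes A :: "complex^'n^'n"
  assumes "invertible A" "\<And>j. (\<Sum>i\<in>UNIV. z i * A $ i $ j) = 0"
  shows "z i = 0"
proof -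
  have "(\<chi> i. z i) v* A = 0"
    using assms(2) by (simp add: vec_eq_iff vector_matrix_mult_def mult.commute)
  then have "((\<chi> i. z i) v* A) v* matrix_inv A = 0" by simp
  then have "(\<chi> i. z i) = 0"
    using assms(1) by (simp add: vector_matrix_mul_assoc matrix_inv_inverse)
  then show ?thesis by (simp add: vec_eq_iff)
qed

text \<open>The system matrix belonging to component \<open>k\<close> of the x_i. Indexing by
  \<open>k\<close> lets \<open>sgn3\<close> absorb the difference between \<open>Bmat\<close> and
  \<open>Mmat\<close>.\<close>

definition BMmat :: "3 \<Rightarrow> complex \<Rightarrow> ('n::finite \<Rightarrow> complex) \<Rightarrow> ('n \<Rightarrow> complex^3) \<Rightarrow> complex^'n^'n" where
  "BMmat k \<sigma> lam y = (if k = 1 then Bmat \<sigma> lam y else Mmat \<sigma> lam y)"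

lemma BMmat_nth:
  "BMmat k \<sigma> lam y $ i $ j = - (bra_J \<sigma> (y i) (y j) / (lam j - cnj (lam i)) - sgn3 k * bra_J3 \<sigma> (y i) (y j) / (lam j + cnj (lam i)))"
proof -
  have "c / (cnj (lam i) - lam j) = - (c / (lam j - cnj (lam i)))" for c
    by (metis minus_diff_eq minus_divide_right)
  then show ?thesis by (simp add: BMmat_def Bmat_def Mmat_def bra_J_def bra_J3_def sgn3_def add.commute)
qed

lemma xvec_BMmat:
  assumes "invertible (BMmat k \<sigma> lam y)"
  shows "(\<Sum>i\<in>UNIV. xvec \<sigma> lam y i $ k * BMmat k \<sigma> lam y $ i $ j) = y j $ k"
  using vec_mult_matrix_inv[OF assms, of "\<chi> j. y j $ k" j] by (simp add: xvec_def BMmat_def)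

text \<open>By \<open>BMmat_nth\<close>, entry (i, j) of \<open>BMmat k\<close> is minus the
  coefficient of the k-th component of x_i in component \<open>k\<close> of T(lam j) y_j, so the
  system cancels y_j exactly.\<close>

lemma Tmat_kernel:
  assumes "invertible (Bmat \<sigma> lam y)" "invertible (Mmat \<sigma> lam y)"
  shows "Tmat \<sigma> lam y (lam j) *v y j = 0"
proof -
  have "(Tmat \<sigma> lam y (lam j) *v y j) $ k = 0" for k
  proof -
    have "invertible (BMmat k \<sigma> lam y)" using assms by (simp add: BMmat_def)
    from xvec_BMmat[OF this, of j] show ?thesis
      unfolding Tmat_vec_nth BMmat_nth mult_minus_right sum_negf by (simp add: neg_eq_iff_add_eq_0 add.commute)
  qed
  then show ?thesis by (simp add: vec_eq_iff)
qed

text \<open>J and J sigma3 are Hermitian. Under conjugate transposition the denominator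
  \<open>cnj (lam i) - lam j\<close> changes sign, while \<open>cnj (lam i) + lam j\<close> is
  preserved.\<close>

lemma Mmat_eq_Bmat_adjoint:
  assumes "\<sigma> = 1 \<or> \<sigma> = -1"
  shows "Mmat \<sigma> lam y $ i $ j = - cnj (Bmat \<sigma> lam y $ j $ i)"
proof -
  have h: "cnj (bra_J \<sigma> (y j) (y i)) = bra_J \<sigma> (y i) (y j)" "cnj (bra_J3 \<sigma> (y j) (y i)) = bra_J3 \<sigma> (y i) (y j)"
    using assms by (auto simp: bra_J_expand bra_J3_expand)
  have "c / (cnj (lam i) - lam j) = - (c / (lam j - cnj (lam i)))" for c
    by (metis minus_diff_eq minus_divide_right)
  then show ?thesis
    using h by (simp add: Mmat_def Bmat_def bra_J_def bra_J3_def add.commute)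
qed

text \<open>Expanding y through the defining systems, both sides become the same double sum over
  \<open>Bmat\<close>, because M is minus the adjoint of B. This symmetry makes the first row of the
  dressed potential match its first column.\<close>

lemma xvec_duality:
  assumes "\<sigma> = 1 \<or> \<sigma> = -1" "invertible (Bmat \<sigma> lam y)" "invertible (Mmat \<sigma> lam y)" "k \<noteq> 1"
  shows "(\<Sum>i\<in>UNIV. xvec \<sigma> lam y i $ 1 * cnj (y i $ k)) = - cnj (\<Sum>i\<in>UNIV. xvec \<sigma> lam y i $ k * cnj (y i $ 1))"
proof -
  let ?x = "xvec \<sigma> lam y"
  have 1: "y j $ 1 = (\<Sum>i\<in>UNIV. ?x i $ 1 * Bmat \<sigma> lam y $ i $ j)" for j
    using xvec_BMmat[of 1 \<sigma> lam y j] assms by (simp add: BMmat_def)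
  have 2: "y j $ k = (\<Sum>m\<in>UNIV. ?x m $ k * Mmat \<sigma> lam y $ m $ j)" for j
    using xvec_BMmat[of k \<sigma> lam y j] assms by (simp add: BMmat_def)
  have "(\<Sum>i\<in>UNIV. ?x i $ 1 * cnj (y i $ k))
      = (\<Sum>i\<in>UNIV. \<Sum>m\<in>UNIV. - (?x i $ 1 * Bmat \<sigma> lam y $ i $ m * cnj (?x m $ k)))"
    by (simp add: 2 Mmat_eq_Bmat_adjoint[OF assms(1)] sum_distrib_left algebra_simps)
  also have "\<dots> = (\<Sum>m\<in>UNIV. \<Sum>i\<in>UNIV. - (?x i $ 1 * Bmat \<sigma> lam y $ i $ m * cnj (?x m $ k)))"
    by (rule sum.swap)
  also have "\<dots> = - (\<Sum>m\<in>UNIV. y m $ 1 * cnj (?x m $ k))"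
    by (simp add: 1 sum_distrib_right sum_negf)
  also have "\<dots> = - cnj (\<Sum>i\<in>UNIV. ?x i $ k * cnj (y i $ 1))"
    by (simp add: mult.commute)
  finally show ?thesis .
qed

lemma u_dressed_nth:
  "u_dressed \<sigma> lam y (vector [a, b]) $ 1 = a + 2 * (\<Sum>i\<in>UNIV. xvec \<sigma> lam y i $ 2 * cnj (y i $ 1))"
  "u_dressed \<sigma> lam y (vector [a, b]) $ 2 = b + 2 * (\<Sum>i\<in>UNIV. xvec \<sigma> lam y i $ 3 * cnj (y i $ 1))"
  by (simp_all add: u_dressed_def Let_def xvec_def matrix_vector_mult_def matrix_matrix_mult_def
      vector_matrix_mult_def vector_2 algebra_simps)

lemma matrix_eq_vecI: "(\<And>v. A *v v = B *v (v :: complex^'m)) \<Longrightarrow> A = B"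
  by (simp add: matrix_eq)

text \<open>A - sigma3 A sigma3 keeps twice the off-diagonal blocks of A. The first column gives the
  new potentials directly, and the first row is its required conjugate by
  \<open>xvec_duality\<close>.\<close>

lemma Q_dressed_eq_Qmat:
  assumes "\<sigma> = 1 \<or> \<sigma> = -1" "invertible (Bmat \<sigma> lam y)" "invertible (Mmat \<sigma> lam y)"
  shows "Q_dressed \<sigma> lam y (Qmat \<sigma> a b) =
    Qmat \<sigma> (u_dressed \<sigma> lam y (vector [a, b]) $ 1) (u_dressed \<sigma> lam y (vector [a, b]) $ 2)"
proof (rule matrix_eq_vecI)
  fix v :: "complex^3"
  let ?x = "xvec \<sigma> lam y"
  have s: "cnj \<sigma> = \<sigma>" using assms(1) by auto
  let ?S = "\<lambda>k. \<Sum>i\<in>UNIV. ?x i $ k * cnj (y i $ 1)"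
  \<comment> \<open>The difference of the two forms sees only components 2 and 3 of
    \<open>v\<close>, their sum only component 1.\<close>
  have p: "bra_J \<sigma> (y i) v - bra_J3 \<sigma> (y i) v = - 2 * (cnj (y i $ 2) * v $ 2 + \<sigma> * (cnj (y i $ 3) * v $ 3))"
    "bra_J \<sigma> (y i) v + bra_J3 \<sigma> (y i) v = 2 * (cnj (y i $ 1) * v $ 1)" for i
    by (simp_all add: bra_J_expand bra_J3_expand algebra_simps)
  have e: "(\<Sum>i\<in>UNIV. ?x i $ k * (bra_J \<sigma> (y i) v + bra_J3 \<sigma> (y i) v)) = 2 * ?S k * v $ 1" for k
    unfolding p by (simp add: sum_distrib_left sum_distrib_right algebra_simps)
  have "(\<Sum>i\<in>UNIV. ?x i $ 1 * (bra_J \<sigma> (y i) v - bra_J3 \<sigma> (y i) v))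
     = (\<Sum>i\<in>UNIV. - 2 * v $ 2 * (?x i $ 1 * cnj (y i $ 2)) - 2 * \<sigma> * v $ 3 * (?x i $ 1 * cnj (y i $ 3)))"
    unfolding p by (intro sum.cong) (simp_all add: algebra_simps)
  also have "\<dots> = - 2 * v $ 2 * (\<Sum>i\<in>UNIV. ?x i $ 1 * cnj (y i $ 2))
      - 2 * \<sigma> * v $ 3 * (\<Sum>i\<in>UNIV. ?x i $ 1 * cnj (y i $ 3))"
    by (simp only: sum_subtractf sum_distrib_left)
  also have "\<dots> = 2 * v $ 2 * cnj (?S 2) + 2 * \<sigma> * v $ 3 * cnj (?S 3)"
    using xvec_duality[OF assms, of 2] xvec_duality[OF assms, of 3] by simp
  finally have f: "(\<Sum>i\<in>UNIV. ?x i $ 1 * (bra_J \<sigma> (y i) v - bra_J3 \<sigma> (y i) v))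
     = 2 * v $ 2 * cnj (?S 2) + 2 * \<sigma> * v $ 3 * cnj (?S 3)" .
  have "(Q_dressed \<sigma> lam y (Qmat \<sigma> a b) *v v) $ k =
    (Qmat \<sigma> (a + 2 * ?S 2) (b + 2 * ?S 3) *v v) $ k" for k
    using exhaust_3[of k] f e[of 2] e[of 3]
    by (elim disjE) (simp_all only: Q_dressed_vec Qmat_vec sgn3_simps mult_1 mult_minus1 diff_minus_eq_add
        complex_cnj_add complex_cnj_mult complex_cnj_numeral, simp_all only: algebra_simps)
  then show "Q_dressed \<sigma> lam y (Qmat \<sigma> a b) *v v =
    Qmat \<sigma> (u_dressed \<sigma> lam y (vector [a, b]) $ 1) (u_dressed \<sigma> lam y (vector [a, b]) $ 2) *v v"
    unfolding vec_eq_iff u_dressed_nth by blast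
qed

section \<open>Derivatives of solutions of the Lax pair\<close>

context
  fixes u1 u2 :: "real \<times> real \<Rightarrow> complex" and p :: "real \<times> real"
  assumes u: "u1 differentiable (at p)" "u2 differentiable (at p)"
begin

lemma differentiable_Qmat_nth: "(\<lambda>q. Qmat \<sigma> (u1 q) (u2 q) $ k $ l) differentiable (at p)"
  using exhaust_3[of k] exhaust_3[of l] u
  by (auto simp: Qmat_def vector_3 intro!: differentiable_mult differentiable_const differentiable_cnj)

lemma differentiable_Qmat: "(\<lambda>q. Qmat \<sigma> (u1 q) (u2 q)) differentiable (at p)"
  by (intro differentiable_vecI differentiable_Qmat_nth)

lemma dderiv_Qmat:
  "dderiv e (\<lambda>q. Qmat \<sigma> (u1 q) (u2 q)) p = Qmat \<sigma> (dderiv e u1 p) (dderiv e u2 p)"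
proof -
  have "dderiv e (\<lambda>q. Qmat \<sigma> (u1 q) (u2 q)) p $ k $ l = Qmat \<sigma> (dderiv e u1 p) (dderiv e u2 p) $ k $ l" for k l
  proof -
    have "dderiv e (\<lambda>q. Qmat \<sigma> (u1 q) (u2 q)) p $ k $ l = dderiv e (\<lambda>q. Qmat \<sigma> (u1 q) (u2 q) $ k $ l) p"
      using dderiv_vec_nth[OF differentiable_Qmat] dderiv_vec_nth[OF differentiable_vec_nth[OF differentiable_Qmat]]
      by metis
    also have "\<dots> = Qmat \<sigma> (dderiv e u1 p) (dderiv e u2 p) $ k $ l"
      using exhaust_3[of k] exhaust_3[of l] u
      by (auto simp: Qmat_def vector_3 dderiv_const dderiv_cnj dderiv_mult differentiable_const differentiable_cnj)
    finally show ?thesis .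
  qed
  then show ?thesis by (simp add: vec_eq_iff)
qed

lemma dx_Qmat:
  "dx (\<lambda>q. Qmat \<sigma> (u1 q) (u2 q)) p = Qmat \<sigma> (dderiv (1, 0) u1 p) (dderiv (1, 0) u2 p)"
  by (simp add: dx_eq_dderiv differentiable_Qmat dderiv_Qmat)

lemma dderiv_Qmat_vec:
  "dderiv e (\<lambda>q. (Qmat \<sigma> (u1 q) (u2 q) *v w) $ k) p = (Qmat \<sigma> (dderiv e u1 p) (dderiv e u2 p) *v w) $ k"
  using exhaust_3[of k] u
  by (auto simp: Qmat_vec dderiv_const dderiv_cnj dderiv_mult dderiv_add differentiable_const differentiable_cnj
      differentiable_mult)

end

lemma differentiable_bra_J:
  fixes f g :: "real \<times> real \<Rightarrow> complex^3"
  assumes "f differentiable (at p)" "g differentiable (at p)"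
  shows "(\<lambda>q. bra_J \<sigma> (f q) (g q)) differentiable (at p)"
  unfolding bra_J_expand
  by (intro differentiable_diff differentiable_mult differentiable_const differentiable_cnj
      differentiable_vec_nth assms)

lemma dderiv_bra_J:
  fixes f g :: "real \<times> real \<Rightarrow> complex^3"
  assumes "f differentiable (at p)" "g differentiable (at p)"
  shows "dderiv e (\<lambda>q. bra_J \<sigma> (f q) (g q)) p = bra_J \<sigma> (dderiv e f p) (g p) + bra_J \<sigma> (f p) (dderiv e g p)"
  unfolding bra_J_expand
  using assms[THEN differentiable_vec_nth] assms[THEN dderiv_vec_nth]
  by (simp add: dderiv_diff dderiv_mult dderiv_const dderiv_cnj differentiable_diff differentiable_mult
      differentiable_const differentiable_cnj)
    (simp add: algebra_simps)

lemma differentiable_sigma3: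
  fixes f :: "real \<times> real \<Rightarrow> complex^3"
  assumes "f differentiable (at p)"
  shows "(\<lambda>q. sigma3 *v f q) differentiable (at p)"
    and "dderiv e (\<lambda>q. sigma3 *v f q) p = sigma3 *v dderiv e f p"
proof -
  note f = differentiable_vec_nth[OF assms]
  show d: "(\<lambda>q. sigma3 *v f q) differentiable (at p)"
    by (rule differentiable_vecI) (simp add: sigma3_vec f)
  show "dderiv e (\<lambda>q. sigma3 *v f q) p = sigma3 *v dderiv e f p"
    unfolding vec_eq_iff dderiv_vec_nth[OF d] sigma3_vec dderiv_vec_nth[OF assms]
    by (simp add: dderiv_mult f dderiv_const)
qed

lemma dderiv_bra_J3:
  fixes f g :: "real \<times> real \<Rightarrow> complex^3"
  assumes "f differentiable (at p)" "g differentiable (at p)"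
  shows "(\<lambda>q. bra_J3 \<sigma> (f q) (g q)) differentiable (at p)"
    and "dderiv e (\<lambda>q. bra_J3 \<sigma> (f q) (g q)) p = bra_J3 \<sigma> (dderiv e f p) (g p) + bra_J3 \<sigma> (f p) (dderiv e g p)"
  unfolding bra_J3_eq_bra_J using differentiable_sigma3[OF assms(2)]
  by (simp_all add: differentiable_bra_J dderiv_bra_J assms)

lemma lax_solutionD:
  assumes "lax_solution Q z S \<Phi>" "p \<in> S"
  shows "\<Phi> differentiable (at p)"
    and "dderiv (1, 0) \<Phi> p = lax_U Q z p *v \<Phi> p" and "dderiv (0, 1) \<Phi> p = lax_V Q z p *v \<Phi> p"
  using assms by (auto simp: lax_solution_def dx_eq_dderiv dt_eq_dderiv)

lemma Ck_on_Qmat_vec: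
  assumes "open S" "Ck_on n S a" "Ck_on n S b" "\<And>k. Ck_on n S (\<lambda>p. w p $ k)"
  shows "Ck_on n S (\<lambda>p. (Qmat \<sigma> (a p) (b p) *v w p) $ k)"
  using exhaust_3[of k]
  by (elim disjE; simp only: Qmat_vec)
    (intro Ck_on_add[OF assms(1)] Ck_on_mult[OF assms(1)] Ck_on_cnj[OF assms(1)] Ck_on_const assms)+

text \<open>Bootstrapping: the Lax pair expresses the first derivatives of \<open>y\<close> linearly
  in \<open>y\<close> with smooth coefficients, so class C^n improves to C^(n+1).\<close>

lemma lax_solution_smooth:
  assumes S: "open S" and u: "smooth_on S u1" "smooth_on S u2"
    and y: "lax_solution (\<lambda>p. Qmat \<sigma> (u1 p) (u2 p)) z S y"
  shows "smooth_on S (\<lambda>p. y p $ k)"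
proof -
  have Cu: "Ck_on n S u1" "Ck_on n S u2" "Ck_on n S (dderiv (1, 0) u1)" "Ck_on n S (dderiv (1, 0) u2)" for n
    using u smooth_on_dderiv[OF S u(1)] smooth_on_dderiv[OF S u(2)] by (auto simp: smooth_on_def)
  have "\<forall>k. Ck_on n S (\<lambda>p. y p $ k)" for n
  proof (induction n)
    case 0
    have "continuous_on S (\<lambda>p. y p $ k)" for k
      by (intro continuous_at_imp_continuous_on ballI differentiable_imp_continuous_within
          differentiable_vec_nth lax_solutionD(1)[OF y])
    then show ?case by simp
  next
    case (Suc n)
    note IH = Suc.IH[rule_format]
    have 1: "Ck_on n S (\<lambda>p. (lax_U (\<lambda>p. Qmat \<sigma> (u1 p) (u2 p)) z p *v y p) $ k)" for k
    proof (rule Ck_on_cong[OF S])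
      show "Ck_on n S (\<lambda>p. \<i> / z\<^sup>2 * (sgn3 k * y p $ k)
          + 1 / z * (Qmat \<sigma> (dderiv (1, 0) u1 p) (dderiv (1, 0) u2 p) *v y p) $ k)"
        by (intro Ck_on_add[OF S] Ck_on_mult[OF S] Ck_on_const Ck_on_Qmat_vec[OF S] IH Cu)
    qed (simp add: lax_U_vec sigma3_vec dx_Qmat smooth_on_differentiable[OF u(1)] smooth_on_differentiable[OF u(2)])
    have 2: "Ck_on n S (\<lambda>p. (lax_V (\<lambda>p. Qmat \<sigma> (u1 p) (u2 p)) z p *v y p) $ k)" for k
    proof (rule Ck_on_cong[OF S])
      show "Ck_on n S (\<lambda>p. \<i> * (sgn3 k * (z\<^sup>2 / 4 * y p $ k
          + 1 / 2 * (Qmat \<sigma> (u1 p) (u2 p) *v (Qmat \<sigma> (u1 p) (u2 p) *v y p)) $ k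
          + (- z / 2) * (Qmat \<sigma> (u1 p) (u2 p) *v y p) $ k)))"
        by (intro Ck_on_add[OF S] Ck_on_mult[OF S] Ck_on_const Ck_on_Qmat_vec[OF S] IH Cu)
    qed (simp add: lax_V_vec sigma3_vec)
    have "Ck_on (Suc n) S (\<lambda>p. y p $ k)" for k
    proof (rule Ck_on_SucI[OF S])
      show "(\<lambda>p. y p $ k) differentiable (at p)" if "p \<in> S" for p
        by (rule differentiable_vec_nth[OF lax_solutionD(1)[OF y that]])
      fix e :: "real \<times> real" assume "e = (1, 0) \<or> e = (0, 1)"
      then show "Ck_on n S (dderiv e (\<lambda>p. y p $ k))"
      proof
        assume e: "e = (1, 0)"
        show ?thesis unfolding e
          by (rule Ck_on_cong[OF S _ 1[of k]])
            (simp add: dderiv_vec_nth[OF lax_solutionD(1)[OF y], symmetric] lax_solutionD(2)[OF y])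
      next
        assume e: "e = (0, 1)"
        show ?thesis unfolding e
          by (rule Ck_on_cong[OF S _ 2[of k]])
            (simp add: dderiv_vec_nth[OF lax_solutionD(1)[OF y], symmetric] lax_solutionD(3)[OF y])
      qed
    qed
    then show ?case by blast
  qed
  then show ?thesis by (simp add: smooth_on_def)
qed

text \<open>Cramer's rule writes the solution as a quotient of determinants, which are polynomial in
  the smooth data. The transpose appears because the unknown is a row vector.\<close>

lemma smooth_on_linear_system:
  fixes A :: "real \<times> real \<Rightarrow> complex^'n^'n" and b x :: "'n \<Rightarrow> real \<times> real \<Rightarrow> complex"
  assumes S: "open S" and A: "\<And>i j. smooth_on S (\<lambda>p. A p $ i $ j)" and b: "\<And>j. smooth_on S (b j)"
    and inv: "\<And>p. p \<in> S \<Longrightarrow> invertible (A p)"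
    and x: "\<And>p j. p \<in> S \<Longrightarrow> (\<Sum>i\<in>UNIV. x i p * A p $ i $ j) = b j p"
  shows "smooth_on S (x m)"
proof -
  let ?D = "\<lambda>p. det (\<chi> i j. if j = m then b i p else A p $ j $ i)"
  have d0: "det (transpose (A p)) \<noteq> 0" if "p \<in> S" for p
    using inv[OF that] by (simp add: invertible_det_nz)
  have eq: "?D p / det (transpose (A p)) = x m p" if "p \<in> S" for p
  proof -
    have "transpose (A p) *v (\<chi> i. x i p) = (\<chi> j. b j p)"
      using x[OF that] by (simp add: vec_eq_iff matrix_vector_mult_def transpose_def mult.commute)
    then have "(\<chi> i. x i p) = (\<chi> k. det (\<chi> i j. if j = k then (\<chi> j. b j p) $ i else transpose (A p) $ i $ j)
        / det (transpose (A p)))"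
      using cramer[OF d0[OF that]] by blast
    then show ?thesis by (simp add: vec_eq_iff transpose_def cong: if_cong)
  qed
  have "smooth_on S (\<lambda>p. ?D p / det (transpose (A p)))"
  proof (intro smooth_on_divide[OF S] smooth_on_det[OF S] d0)
    show "smooth_on S (\<lambda>p. (\<chi> i j. if j = m then b i p else A p $ j $ i) $ i $ j)" for i j
      using A b by (cases "j = m") auto
    show "smooth_on S (\<lambda>p. transpose (A p) $ i $ j)" for i j
      using A by (simp add: transpose_def)
  qed
  then show ?thesis by (rule smooth_on_cong[OF S, rotated]) (rule eq)
qed

lemma smooth_on_bra_J:
  assumes "open S" "\<And>k. smooth_on S (\<lambda>p. f p $ k)" "\<And>k. smooth_on S (\<lambda>p. g p $ k)"
  shows "smooth_on S (\<lambda>p. bra_J \<sigma> (f p) (g p))" "smooth_on S (\<lambda>p. bra_J3 \<sigma> (f p) (g p))"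
  unfolding bra_J_expand bra_J3_expand
  by (intro smooth_on_diff[OF assms(1)] smooth_on_add[OF assms(1)] smooth_on_mult[OF assms(1)]
      smooth_on_cnj[OF assms(1)] smooth_on_const assms)+

section \<open>The dressed Lax pair\<close>

locale darboux =
  fixes \<sigma> :: complex
    and \<Omega> :: "(real \<times> real) set"
    and u1 u2 :: "real \<times> real \<Rightarrow> complex"
    and lam :: "'n::finite \<Rightarrow> complex"
    and y :: "'n \<Rightarrow> real \<times> real \<Rightarrow> complex^3"
  assumes sigma: "\<sigma> = 1 \<or> \<sigma> = -1"
    and open_Omega: "open \<Omega>"
    and smooth_u: "smooth_on \<Omega> u1" "smooth_on \<Omega> u2"
    and lam_nz: "lam i \<noteq> 0"
    and lam_cnj: "(cnj (lam i))\<^sup>2 \<noteq> (lam j)\<^sup>2"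
    and lax_y: "lax_solution (\<lambda>p. Qmat \<sigma> (u1 p) (u2 p)) (lam i) \<Omega> (y i)"
begin

abbreviation "Q \<equiv> \<lambda>p. Qmat \<sigma> (u1 p) (u2 p)"
abbreviation "yp \<equiv> \<lambda>p i. y i p"
abbreviation "B \<equiv> \<lambda>p. Bmat \<sigma> lam (yp p)"
abbreviation "M \<equiv> \<lambda>p. Mmat \<sigma> lam (yp p)"
abbreviation "x \<equiv> \<lambda>i p. xvec \<sigma> lam (yp p) i"
abbreviation "a \<equiv> \<lambda>i. cnj (lam i)"
abbreviation "T \<equiv> \<lambda>z p. Tmat \<sigma> lam (yp p) z"
abbreviation "QN \<equiv> \<lambda>p. Q_dressed \<sigma> lam (yp p) (Q p)"
abbreviation "v1 \<equiv> \<lambda>p. u_dressed \<sigma> lam (yp p) (vector [u1 p, u2 p]) $ 1"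
abbreviation "v2 \<equiv> \<lambda>p. u_dressed \<sigma> lam (yp p) (vector [u1 p, u2 p]) $ 2"

section \<open>The domain of the transformation and smoothness of the dressed quantities\<close>

definition \<Omega>N where "\<Omega>N = {p \<in> \<Omega>. invertible (B p) \<and> invertible (M p)}"

lemma OmegaN_sub: "\<Omega>N \<subseteq> \<Omega>" by (auto simp: \<Omega>N_def)

lemma smooth_y: "smooth_on \<Omega> (\<lambda>p. y i p $ k)"
  by (rule lax_solution_smooth[OF open_Omega smooth_u lax_y])

lemma smooth_BMmat: "smooth_on \<Omega> (\<lambda>p. BMmat k \<sigma> lam (yp p) $ i $ j)"
proof -
  have "BMmat k \<sigma> lam (yp p) $ i $ j = bra_J \<sigma> (y i p) (y j p) * (- (1 / (lam j - a i)))
      + bra_J3 \<sigma> (y i p) (y j p) * (sgn3 k / (lam j + a i))" for p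
    by (simp add: BMmat_nth)
  then show ?thesis
    by (simp only:) (intro smooth_on_add[OF open_Omega] smooth_on_mult[OF open_Omega] smooth_on_const
        smooth_on_bra_J[OF open_Omega] smooth_y)
qed

lemma open_OmegaN: "open \<Omega>N"
proof -
  have c: "continuous_on \<Omega> (\<lambda>p. det (BMmat k \<sigma> lam (yp p)))" for k
    using smooth_on_det[OF open_Omega smooth_BMmat, of k, unfolded smooth_on_def, rule_format, of 0] by simp
  have "open (\<Omega> \<inter> (\<lambda>p. det (BMmat k \<sigma> lam (yp p))) -` (- {0}))" for k
    by (rule continuous_open_preimage[OF c open_Omega]) (simp add: open_Compl)
  from this[of 1] this[of 2] have "open ((\<Omega> \<inter> (\<lambda>p. det (B p)) -` (- {0})) \<inter> (\<Omega> \<inter> (\<lambda>p. det (M p)) -` (- {0})))"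
    by (simp add: BMmat_def open_Int)
  moreover have "\<dots> = \<Omega>N" by (auto simp: \<Omega>N_def invertible_det_nz)
  ultimately show ?thesis by simp
qed

lemma invertible_BMmat: "p \<in> \<Omega>N \<Longrightarrow> invertible (BMmat k \<sigma> lam (yp p))"
  by (simp add: \<Omega>N_def BMmat_def)

lemma smooth_x: "smooth_on \<Omega>N (\<lambda>p. x i p $ k)"
  by (rule smooth_on_linear_system[OF open_OmegaN smooth_on_subset[OF smooth_BMmat OmegaN_sub, of k]
        smooth_on_subset[OF smooth_y OmegaN_sub, of _ k]])
    (use invertible_BMmat xvec_BMmat in blast)+

lemma v_eq:
  "v1 p = u1 p + 2 * (\<Sum>i\<in>UNIV. x i p $ 2 * cnj (y i p $ 1))"
  "v2 p = u2 p + 2 * (\<Sum>i\<in>UNIV. x i p $ 3 * cnj (y i p $ 1))"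
  by (rule u_dressed_nth)+

lemma smooth_v: "smooth_on \<Omega>N v1" "smooth_on \<Omega>N v2"
  unfolding v_eq
  by (intro smooth_on_add[OF open_OmegaN] smooth_on_mult[OF open_OmegaN] smooth_on_const
      smooth_on_sum[OF open_OmegaN] smooth_on_cnj[OF open_OmegaN] smooth_x
      smooth_on_subset[OF smooth_u(1) OmegaN_sub] smooth_on_subset[OF smooth_u(2) OmegaN_sub]
      smooth_on_subset[OF smooth_y OmegaN_sub])+

lemma QN_eq: "p \<in> \<Omega>N \<Longrightarrow> QN p = Qmat \<sigma> (v1 p) (v2 p)"
  by (rule Q_dressed_eq_Qmat[OF sigma]) (auto simp: \<Omega>N_def)

lemma diff_u: "p \<in> \<Omega>N \<Longrightarrow> u1 differentiable (at p)" "p \<in> \<Omega>N \<Longrightarrow> u2 differentiable (at p)"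
  using smooth_u smooth_on_differentiable OmegaN_sub by blast+

lemma diff_v: "p \<in> \<Omega>N \<Longrightarrow> v1 differentiable (at p)" "p \<in> \<Omega>N \<Longrightarrow> v2 differentiable (at p)"
  by (rule smooth_on_differentiable[OF smooth_v(1)] smooth_on_differentiable[OF smooth_v(2)]; assumption)+

lemma diff_x: "p \<in> \<Omega>N \<Longrightarrow> (\<lambda>p. x i p $ k) differentiable (at p)"
  by (rule smooth_on_differentiable[OF smooth_x])

lemma diff_y: "p \<in> \<Omega>N \<Longrightarrow> y i differentiable (at p)"
  using lax_solutionD(1)[OF lax_y] OmegaN_sub by blast

lemma dx_QN:
  assumes p: "p \<in> \<Omega>N"
  shows "dx QN p = Qmat \<sigma> (dderiv (1, 0) v1 p) (dderiv (1, 0) v2 p)"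
proof -
  have "dx QN p = dx (\<lambda>q. Qmat \<sigma> (v1 q) (v2 q)) p"
    by (rule dx_cong_open[OF open_OmegaN p]) (rule QN_eq)
  also have "\<dots> = Qmat \<sigma> (dderiv (1, 0) v1 p) (dderiv (1, 0) v2 p)"
    by (rule dx_Qmat[OF diff_v[OF p]])
  finally show ?thesis .
qed

lemma dx_Q: "p \<in> \<Omega>N \<Longrightarrow> dx Q p = Qmat \<sigma> (dderiv (1, 0) u1 p) (dderiv (1, 0) u2 p)"
  by (rule dx_Qmat[OF diff_u])

text \<open>Testing against a constant vector \<open>w\<close> makes the derivative fall only on Q,
  x_i and y_i. In \<open>dressing_x\<close> the vector is the value of \<Phi> frozen at
  \<open>p\<close>.\<close>

lemma dderiv_QN_vec:
  assumes p: "p \<in> \<Omega>N"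
  shows "(Qmat \<sigma> (dderiv e v1 p) (dderiv e v2 p) *v w) $ k =
     (Qmat \<sigma> (dderiv e u1 p) (dderiv e u2 p) *v w) $ k +
     (\<Sum>i\<in>UNIV. dderiv e (\<lambda>q. x i q $ k) p * (bra_J \<sigma> (y i p) w - sgn3 k * bra_J3 \<sigma> (y i p) w)
        + x i p $ k * (bra_J \<sigma> (dderiv e (y i) p) w - sgn3 k * bra_J3 \<sigma> (dderiv e (y i) p) w))"
proof -
  have z: "(\<lambda>q. w) differentiable (at p)" "dderiv e (\<lambda>q. w) p = 0"
    by (simp_all add: dderiv_const)
  have zero: "bra_J \<sigma> s 0 = 0" "bra_J3 \<sigma> s 0 = 0" for s by (simp_all add: bra_J_expand bra_J3_expand)
  have d: "(\<lambda>q. (Q q *v w) $ k) differentiable (at p)"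
    using exhaust_3[of k] diff_u[OF p]
    by (auto simp: Qmat_vec intro!: differentiable_add differentiable_mult differentiable_cnj differentiable_const)
  have "(Qmat \<sigma> (dderiv e v1 p) (dderiv e v2 p) *v w) $ k = dderiv e (\<lambda>q. (Qmat \<sigma> (v1 q) (v2 q) *v w) $ k) p"
    by (rule dderiv_Qmat_vec[OF diff_v[OF p], symmetric])
  also have "\<dots> = dderiv e (\<lambda>q. (Q q *v w) $ k +
     (\<Sum>i\<in>UNIV. x i q $ k * (bra_J \<sigma> (y i q) w - sgn3 k * bra_J3 \<sigma> (y i q) w))) p"
    by (rule dderiv_cong_open[OF open_OmegaN p]) (simp only: QN_eq[symmetric] Q_dressed_vec)
  also have "\<dots> = (Qmat \<sigma> (dderiv e u1 p) (dderiv e u2 p) *v w) $ k +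
     (\<Sum>i\<in>UNIV. dderiv e (\<lambda>q. x i q $ k) p * (bra_J \<sigma> (y i p) w - sgn3 k * bra_J3 \<sigma> (y i p) w)
        + x i p $ k * (bra_J \<sigma> (dderiv e (y i) p) w - sgn3 k * bra_J3 \<sigma> (dderiv e (y i) p) w))"
    using d diff_x[OF p] diff_y[OF p] z
    by (simp add: dderiv_add dderiv_sum dderiv_mult dderiv_diff dderiv_const dderiv_bra_J dderiv_bra_J3
        differentiable_sum_fun differentiable_mult differentiable_diff differentiable_bra_J
        dderiv_Qmat_vec[OF diff_u[OF p]] zero add.commute)
  finally show ?thesis .
qed

section \<open>The dressing identities and the Lax equations for the x_i\<close>

lemma dderiv_Tmat:
  assumes p: "p \<in> \<Omega>N" and \<Phi>: "\<Phi> differentiable (at p)"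
  shows "(\<lambda>q. (T z q *v \<Phi> q) $ k) differentiable (at p)"
    and "dderiv e (\<lambda>q. (T z q *v \<Phi> q) $ k) p = dderiv e \<Phi> p $ k +
      (\<Sum>i\<in>UNIV. dderiv e (\<lambda>q. x i q $ k) p
          * (bra_J \<sigma> (y i p) (\<Phi> p) / (z - a i) - sgn3 k * bra_J3 \<sigma> (y i p) (\<Phi> p) / (z + a i))
        + x i p $ k
          * ((bra_J \<sigma> (dderiv e (y i) p) (\<Phi> p) + bra_J \<sigma> (y i p) (dderiv e \<Phi> p)) / (z - a i)
            - sgn3 k * (bra_J3 \<sigma> (dderiv e (y i) p) (\<Phi> p) + bra_J3 \<sigma> (y i p) (dderiv e \<Phi> p)) / (z + a i)))"
proof -
  \<comment> \<open>Naming the constant quotients leaves only sums and products for the derivative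
    rules.\<close>
  define c d where "c = (\<lambda>i. 1 / (z - a i))" and "d = (\<lambda>i. sgn3 k / (z + a i))"
  have eq: "(T z q *v \<Phi> q) $ k = \<Phi> q $ k + (\<Sum>i\<in>UNIV. x i q $ k *
      (c i * bra_J \<sigma> (y i q) (\<Phi> q) - d i * bra_J3 \<sigma> (y i q) (\<Phi> q)))" for q
    by (simp add: Tmat_vec_nth c_def d_def)
  note df = differentiable_vec_nth[OF \<Phi>] diff_x[OF p] differentiable_bra_J[OF diff_y[OF p] \<Phi>]
    dderiv_bra_J3(1)[OF diff_y[OF p] \<Phi>] differentiable_const[of _ "at p"]
  show "(\<lambda>q. (T z q *v \<Phi> q) $ k) differentiable (at p)"
    unfolding eq by (intro differentiable_add differentiable_sum_fun differentiable_mult differentiable_diff df)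
  show "dderiv e (\<lambda>q. (T z q *v \<Phi> q) $ k) p = dderiv e \<Phi> p $ k +
      (\<Sum>i\<in>UNIV. dderiv e (\<lambda>q. x i q $ k) p
          * (bra_J \<sigma> (y i p) (\<Phi> p) / (z - a i) - sgn3 k * bra_J3 \<sigma> (y i p) (\<Phi> p) / (z + a i))
        + x i p $ k
          * ((bra_J \<sigma> (dderiv e (y i) p) (\<Phi> p) + bra_J \<sigma> (y i p) (dderiv e \<Phi> p)) / (z - a i)
            - sgn3 k * (bra_J3 \<sigma> (dderiv e (y i) p) (\<Phi> p) + bra_J3 \<sigma> (y i p) (dderiv e \<Phi> p)) / (z + a i)))"
    unfolding eq
    by (simp add: df dderiv_add dderiv_sum dderiv_mult dderiv_diff dderiv_const differentiable_sum_fun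
        differentiable_mult differentiable_diff dderiv_bra_J[OF diff_y[OF p] \<Phi>] dderiv_bra_J3(2)[OF diff_y[OF p] \<Phi>]
        dderiv_vec_nth[OF \<Phi>] add.commute) (simp add: c_def d_def)
qed

lemma dressing_x:
  assumes p: "p \<in> \<Omega>N" and z: "z \<noteq> 0" "\<And>i. z \<noteq> a i" "\<And>i. z \<noteq> - a i"
    and \<Phi>: "\<Phi> differentiable (at p)" "dderiv (1, 0) \<Phi> p = lax_U Q z p *v \<Phi> p"
  shows "dderiv (1, 0) (\<lambda>q. (T z q *v \<Phi> q) $ k) p - (lax_U QN z p *v (T z p *v \<Phi> p)) $ k =
    (\<Sum>i\<in>UNIV. a i / z * ((dderiv (1, 0) (\<lambda>q. x i q $ k) p - (lax_U QN (a i) p *v x i p) $ k)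
      * (bra_J \<sigma> (y i p) (\<Phi> p) / (z - a i) + sgn3 k * bra_J3 \<sigma> (y i p) (\<Phi> p) / (z + a i))))"
proof -
  define Qx Qx' where "Qx = Qmat \<sigma> (dderiv (1, 0) u1 p) (dderiv (1, 0) u2 p)"
    and "Qx' = Qmat \<sigma> (dderiv (1, 0) v1 p) (dderiv (1, 0) v2 p)"
  define v g h q r where "v = \<Phi> p" and "g = (\<lambda>i. bra_J \<sigma> (y i p) v)" and "h = (\<lambda>i. bra_J3 \<sigma> (y i p) v)"
    and "q = (\<lambda>i. bra_J \<sigma> (y i p) (Qx *v v))" and "r = (\<lambda>i. bra_J3 \<sigma> (y i p) (Qx *v v))"
  define X X' P where "X = (\<lambda>i. x i p $ k)" and "X' = (\<lambda>i. dderiv (1, 0) (\<lambda>q. x i q $ k) p)"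
    and "P = (\<lambda>i. (Qx' *v x i p) $ k)"
  define g0 h0 where "g0 = (\<lambda>i. - (\<i> / (a i)\<^sup>2 * h i + q i / a i))"
    and "h0 = (\<lambda>i. - (\<i> / (a i)\<^sup>2 * g i - r i / a i))"
  note defs = Qx_def Qx'_def v_def g_def h_def q_def r_def X_def X'_def P_def
  have pO: "p \<in> \<Omega>" using p OmegaN_sub by blast
  have dy: "dderiv (1, 0) (y i) p = lax_U Q (lam i) p *v y i p" for i
    by (rule lax_solutionD(2)[OF lax_y pO])
  have U: "lax_U Q w p *v s = (\<i> / w\<^sup>2) *s (sigma3 *v s) + (1 / w) *s (Qx *v s)" for w s
    by (simp add: lax_U_vec dx_Q[OF p] Qx_def)
  have UN: "(lax_U QN w p *v s) $ k = \<i> / w\<^sup>2 * (sgn3 k * s $ k) + (Qx' *v s) $ k / w" for w s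
    by (simp add: lax_U_vec dx_QN[OF p] Qx'_def sigma3_vec)
  have g0: "bra_J \<sigma> (dderiv (1, 0) (y i) p) v = g0 i" and h0: "bra_J3 \<sigma> (dderiv (1, 0) (y i) p) v = h0 i" for i
    by (simp_all add: dy U bra_J_linear bra_J3_linear bra_J_sigma3 g0_def h0_def g_def h_def q_def r_def Qx_def bra_J_Qmat[OF sigma])
  have g1: "bra_J \<sigma> (y i p) (dderiv (1, 0) \<Phi> p) = \<i> / z\<^sup>2 * h i + q i / z"
    and h1: "bra_J3 \<sigma> (y i p) (dderiv (1, 0) \<Phi> p) = \<i> / z\<^sup>2 * g i + r i / z" for i
    by (simp_all add: \<Phi>(2) U bra_J_linear bra_J3_linear bra_J_sigma3 g_def h_def q_def r_def v_def)
  have v': "dderiv (1, 0) \<Phi> p $ k = \<i> / z\<^sup>2 * (sgn3 k * v $ k) + (Qx *v v) $ k / z"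
    by (simp add: \<Phi>(2) U sigma3_vec v_def)
  let ?c = "\<lambda>i. g i / (z - a i) - sgn3 k * h i / (z + a i)"
  let ?d = "\<lambda>i. g i / (z - a i) + sgn3 k * h i / (z + a i)"
  have 1: "dderiv (1, 0) (\<lambda>q. (T z q *v \<Phi> q) $ k) p = \<i> / z\<^sup>2 * (sgn3 k * v $ k) + (Qx *v v) $ k / z +
      (\<Sum>i\<in>UNIV. X' i * ?c i + X i * ((g0 i + (\<i> / z\<^sup>2 * h i + q i / z)) / (z - a i)
        - sgn3 k * (h0 i + (\<i> / z\<^sup>2 * g i + r i / z)) / (z + a i)))"
    unfolding dderiv_Tmat(2)[OF p \<Phi>(1)] v' v_def[symmetric] g0 h0 g1 h1
    by (simp add: X_def X'_def g_def h_def)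
  have 2: "(lax_U QN z p *v (T z p *v \<Phi> p)) $ k = \<i> / z\<^sup>2 * (sgn3 k * (v $ k + (\<Sum>i\<in>UNIV. X i * ?c i)))
      + ((Qx *v v) $ k + (\<Sum>i\<in>UNIV. X' i * (g i - sgn3 k * h i) + X i * (g0 i - sgn3 k * h0 i))
        + (\<Sum>i\<in>UNIV. P i * ?d i)) / z"
    unfolding UN Qx'_def Qmat_Tmat_vec v_def[symmetric] dderiv_QN_vec[OF p, where w = v] Tmat_vec_nth v_def[symmetric] g0 h0
    by (simp add: X_def X'_def P_def Qx_def Qx'_def g_def h_def)
  \<comment> \<open>The terms outside the sums in \<open>1\<close> and \<open>2\<close> are those of
    the undressed equation and cancel, leaving a single sum to which \<open>dressing_x_term\<close>
    applies termwise.\<close>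
  have "dderiv (1, 0) (\<lambda>q. (T z q *v \<Phi> q) $ k) p - (lax_U QN z p *v (T z p *v \<Phi> p)) $ k =
    (\<Sum>i\<in>UNIV. X' i * ?c i
      + X i * ((g0 i + (\<i> / z\<^sup>2 * h i + q i / z)) / (z - a i) - sgn3 k * (h0 i + (\<i> / z\<^sup>2 * g i + r i / z)) / (z + a i))
      - \<i> * sgn3 k / z\<^sup>2 * (X i * ?c i)
      - (X' i * (g i - sgn3 k * h i) + X i * (g0 i - sgn3 k * h0 i) + P i * ?d i) / z)"
    unfolding 1 2 sum.distrib sum_subtractf sum_distrib_left[symmetric] sum_divide_distrib[symmetric]
    by (simp add: add_divide_distrib algebra_simps)
  also have "\<dots> = (\<Sum>i\<in>UNIV. a i / z * ((X' i - (\<i> * sgn3 k / (a i)\<^sup>2 * X i + P i / a i)) * ?d i))"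
    by (intro sum.cong refl dressing_x_term sgn3_cases)
      (use z lam_nz in \<open>auto simp: g0_def h0_def eq_neg_iff_add_eq_0\<close>)
  finally show ?thesis
    unfolding UN by (simp add: defs mult.assoc mult.commute)
qed

lemma dressing_t:
  assumes p: "p \<in> \<Omega>N" and z: "\<And>i. z \<noteq> a i" "\<And>i. z \<noteq> - a i"
    and \<Phi>: "\<Phi> differentiable (at p)" "dderiv (0, 1) \<Phi> p = lax_V Q z p *v \<Phi> p"
  shows "dderiv (0, 1) (\<lambda>q. (T z q *v \<Phi> q) $ k) p - (lax_V QN z p *v (T z p *v \<Phi> p)) $ k =
    (\<Sum>i\<in>UNIV. (dderiv (0, 1) (\<lambda>q. x i q $ k) p - (lax_V QN (a i) p *v x i p) $ k)
      * (bra_J \<sigma> (y i p) (\<Phi> p) / (z - a i) - sgn3 k * bra_J3 \<sigma> (y i p) (\<Phi> p) / (z + a i)))"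
proof -
  define q0 q1 where "q0 = Q p" and "q1 = QN p"
  define v g h q r q2 r2 where "v = \<Phi> p" and "g = (\<lambda>i. bra_J \<sigma> (y i p) v)" and "h = (\<lambda>i. bra_J3 \<sigma> (y i p) v)"
    and "q = (\<lambda>i. bra_J \<sigma> (y i p) (q0 *v v))" and "r = (\<lambda>i. bra_J3 \<sigma> (y i p) (q0 *v v))"
    and "q2 = (\<lambda>i. bra_J \<sigma> (y i p) (q0 *v (q0 *v v)))" and "r2 = (\<lambda>i. bra_J3 \<sigma> (y i p) (q0 *v (q0 *v v)))"
  define X X' P P2 where "X = (\<lambda>i. x i p $ k)" and "X' = (\<lambda>i. dderiv (0, 1) (\<lambda>q. x i q $ k) p)"
    and "P = (\<lambda>i. (q1 *v x i p) $ k)" and "P2 = (\<lambda>i. (q1 *v (q1 *v x i p)) $ k)"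
  define g0 h0 where "g0 = (\<lambda>i. - \<i> * ((a i)\<^sup>2 / 4 * h i + r2 i / 2 - a i / 2 * r i))"
    and "h0 = (\<lambda>i. - \<i> * ((a i)\<^sup>2 / 4 * g i + q2 i / 2 + a i / 2 * q i))"
  note defs = q0_def q1_def v_def g_def h_def q_def r_def q2_def r2_def X_def X'_def P_def P2_def
  have pO: "p \<in> \<Omega>" using p OmegaN_sub by blast
  have dy: "dderiv (0, 1) (y i) p = lax_V Q (lam i) p *v y i p" for i
    by (rule lax_solutionD(3)[OF lax_y pO])
  have V: "lax_V Q w p *v s = \<i> *s (sigma3 *v ((w\<^sup>2 / 4) *s s + (1 / 2) *s (q0 *v (q0 *v s)) - (w / 2) *s (q0 *v s)))" for w s
    by (simp add: lax_V_vec q0_def)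
  have VN: "(lax_V QN w p *v s) $ k = \<i> * sgn3 k * (w\<^sup>2 / 4 * s $ k + (q1 *v (q1 *v s)) $ k / 2 - w / 2 * (q1 *v s) $ k)" for w s
    by (simp add: lax_V_vec q1_def sigma3_vec)
  have g0: "bra_J \<sigma> (dderiv (0, 1) (y i) p) v = g0 i" and h0: "bra_J3 \<sigma> (dderiv (0, 1) (y i) p) v = h0 i" for i
    by (simp_all add: dy V bra_J_linear bra_J3_linear bra_J_sigma3 g0_def h0_def g_def h_def q_def r_def q2_def r2_def q0_def
        bra_J_Qmat[OF sigma])
  have g1: "bra_J \<sigma> (y i p) (dderiv (0, 1) \<Phi> p) = \<i> * (z\<^sup>2 / 4 * h i + r2 i / 2 - z / 2 * r i)"
    and h1: "bra_J3 \<sigma> (y i p) (dderiv (0, 1) \<Phi> p) = \<i> * (z\<^sup>2 / 4 * g i + q2 i / 2 - z / 2 * q i)" for i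
    by (simp_all add: \<Phi>(2) V bra_J_linear bra_J3_linear bra_J_sigma3 g_def h_def q_def r_def q2_def r2_def v_def)
  have v': "dderiv (0, 1) \<Phi> p $ k = \<i> * sgn3 k * (z\<^sup>2 / 4 * v $ k + (q0 *v (q0 *v v)) $ k / 2 - z / 2 * (q0 *v v) $ k)"
    by (simp add: \<Phi>(2) V sigma3_vec v_def)
  let ?c = "\<lambda>i. g i / (z - a i) - sgn3 k * h i / (z + a i)"
  let ?d = "\<lambda>i. g i / (z - a i) + sgn3 k * h i / (z + a i)"
  have 1: "dderiv (0, 1) (\<lambda>q. (T z q *v \<Phi> q) $ k) p
      = \<i> * sgn3 k * (z\<^sup>2 / 4 * v $ k + (q0 *v (q0 *v v)) $ k / 2 - z / 2 * (q0 *v v) $ k) +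
      (\<Sum>i\<in>UNIV. X' i * ?c i + X i * ((g0 i + \<i> * (z\<^sup>2 / 4 * h i + r2 i / 2 - z / 2 * r i)) / (z - a i)
        - sgn3 k * (h0 i + \<i> * (z\<^sup>2 / 4 * g i + q2 i / 2 - z / 2 * q i)) / (z + a i)))"
    unfolding dderiv_Tmat(2)[OF p \<Phi>(1)] v' v_def[symmetric] g0 h0 g1 h1
    by (simp add: X_def X'_def g_def h_def)
  have q1: "q1 = Qmat \<sigma> (v1 p) (v2 p)" unfolding q1_def by (rule QN_eq[OF p])
  have q1v: "(q1 *v s) $ k = (q0 *v s) $ k + (\<Sum>i\<in>UNIV. X i * (bra_J \<sigma> (y i p) s - sgn3 k * bra_J3 \<sigma> (y i p) s))" for s
    by (simp add: q1_def q0_def Q_dressed_vec X_def)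
  have q1v_vec: "q1 *v s = q0 *v s + (\<Sum>i\<in>UNIV. bra_J \<sigma> (y i p) s *s x i p - bra_J3 \<sigma> (y i p) s *s (sigma3 *v x i p))" for s
    by (simp add: vec_eq_iff q1_def q0_def Q_dressed_vec sigma3_vec algebra_simps)
  \<comment> \<open>Only the inner factor Q[N] is expanded; the outer one acts on the x_i and
    produces the terms \<open>P i\<close>. The remaining product Q[N] Q v is expanded in
    \<open>q1q0\<close>.\<close>
  have q1q1: "(q1 *v (q1 *v v)) $ k = (q1 *v (q0 *v v)) $ k + (\<Sum>i\<in>UNIV. P i * (g i + sgn3 k * h i))"
    unfolding q1v_vec[of v]
    by (simp add: matrix_vector_right_distrib matrix_vector_mult_diff_distrib matrix_vec_sum vector_scalar_commute
        q1 Qmat_sigma3 sigma3_vec P_def g_def h_def algebra_simps)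
  have q1q0: "(q1 *v (q0 *v v)) $ k = (q0 *v (q0 *v v)) $ k + (\<Sum>i\<in>UNIV. X i * (q i - sgn3 k * r i))"
    by (simp add: q1v[of "q0 *v v"] q_def r_def)
  have 2: "(lax_V QN z p *v (T z p *v \<Phi> p)) $ k = \<i> * sgn3 k * (z\<^sup>2 / 4 * (v $ k + (\<Sum>i\<in>UNIV. X i * ?c i))
      + ((q0 *v (q0 *v v)) $ k + (\<Sum>i\<in>UNIV. X i * (q i - sgn3 k * r i)) + (\<Sum>i\<in>UNIV. P i * (g i + sgn3 k * h i))
         + (\<Sum>i\<in>UNIV. P2 i * ?c i)) / 2
      - z / 2 * ((q0 *v v) $ k + (\<Sum>i\<in>UNIV. X i * (g i - sgn3 k * h i)) + (\<Sum>i\<in>UNIV. P i * ?d i)))"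
    unfolding VN v_def[symmetric] q1 Qmat_Tmat_vec Qmat_Qmat_Tmat_vec
    unfolding q1[symmetric] q1q1 q1q0 q1v[of v] Tmat_vec_nth
    by (simp add: X_def P_def P2_def g_def h_def)
  have "dderiv (0, 1) (\<lambda>q. (T z q *v \<Phi> q) $ k) p - (lax_V QN z p *v (T z p *v \<Phi> p)) $ k =
    (\<Sum>i\<in>UNIV. X' i * ?c i
      + X i * ((g0 i + \<i> * (z\<^sup>2 / 4 * h i + r2 i / 2 - z / 2 * r i)) / (z - a i)
        - sgn3 k * (h0 i + \<i> * (z\<^sup>2 / 4 * g i + q2 i / 2 - z / 2 * q i)) / (z + a i))
      - \<i> * sgn3 k * (z\<^sup>2 / 4 * (X i * ?c i)
          + (P i * (g i + sgn3 k * h i) + X i * (q i - sgn3 k * r i) + P2 i * ?c i) / 2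
          - z / 2 * (X i * (g i - sgn3 k * h i) + P i * ?d i)))"
    unfolding 1 2 sum.distrib sum_subtractf sum_distrib_left[symmetric] sum_divide_distrib[symmetric]
    by (simp add: add_divide_distrib algebra_simps)
  also have "\<dots> = (\<Sum>i\<in>UNIV. (X' i - \<i> * sgn3 k * ((a i)\<^sup>2 / 4 * X i + P2 i / 2 - a i / 2 * P i)) * ?c i)"
    by (intro sum.cong refl dressing_t_term sgn3_cases)
      (use z in \<open>auto simp: g0_def h0_def eq_neg_iff_add_eq_0\<close>)
  finally show ?thesis
    unfolding VN by (simp add: defs)
qed

text \<open>The poles of T are the points \<open>a i\<close> and \<open>- a i\<close>, so T may be
  evaluated at every \<open>lam j\<close>.\<close>

lemma lam_poles: "lam j \<noteq> a i" "lam j \<noteq> - a i"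
  using lam_cnj[of i j] by auto

lemma Tmat_y: "p \<in> \<Omega>N \<Longrightarrow> T (lam j) p *v y j p = 0"
  by (rule Tmat_kernel) (auto simp: \<Omega>N_def)

lemma dderiv_Tmat_y:
  assumes p: "p \<in> \<Omega>N"
  shows "dderiv e (\<lambda>q. (T (lam j) q *v y j q) $ k) p = 0"
proof -
  have "dderiv e (\<lambda>q. (T (lam j) q *v y j q) $ k) p = dderiv e (\<lambda>q. 0) p"
    by (rule dderiv_cong_open[OF open_OmegaN p]) (simp add: Tmat_y)
  then show ?thesis by (simp add: dderiv_const)
qed

text \<open>Letting \<open>j\<close> vary in \<open>dressing_x\<close> at \<open>lam j\<close> gives
  a homogeneous linear system for the quantities \<open>a i * w i\<close>, and \<open>a i\<close> is
  nonzero.\<close>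

lemma x_lax_U:
  assumes p: "p \<in> \<Omega>N"
  shows "dderiv (1, 0) (\<lambda>q. x i q $ k) p = (lax_U QN (a i) p *v x i p) $ k"
proof -
  define w where "w = (\<lambda>i. dderiv (1, 0) (\<lambda>q. x i q $ k) p - (lax_U QN (a i) p *v x i p) $ k)"
  \<comment> \<open>In \<open>dressing_x\<close> the defect of component \<open>k\<close> appears with the sign of the other block of \<open>\<sigma>\<^sub>3\<close>:
    component 1 is controlled by \<open>M\<close>, components 2 and 3 by \<open>B\<close>.\<close>
  define k' :: 3 where "k' = (if k = 1 then 2 else 1)"
  have k': "sgn3 k' = - sgn3 k" by (simp add: k'_def sgn3_def)
  have pO: "p \<in> \<Omega>" using p OmegaN_sub by blast
  have "(\<Sum>i\<in>UNIV. a i * w i * BMmat k' \<sigma> lam (yp p) $ i $ j) = 0" for j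
  proof -
    have "0 = (\<Sum>i\<in>UNIV. a i / lam j * (w i
      * (bra_J \<sigma> (y i p) (y j p) / (lam j - a i) + sgn3 k * bra_J3 \<sigma> (y i p) (y j p) / (lam j + a i))))"
      using dressing_x[OF p lam_nz lam_poles lax_solutionD(1,2)[OF lax_y pO], of j k]
      by (simp add: dderiv_Tmat_y[OF p] Tmat_y[OF p] w_def)
    also have "\<dots> = (\<Sum>i\<in>UNIV. (- 1 / lam j) * (a i * w i * BMmat k' \<sigma> lam (yp p) $ i $ j))"
      by (intro sum.cong refl) (simp add: BMmat_nth k' algebra_simps)
    finally show ?thesis unfolding sum_distrib_left[symmetric] using lam_nz[of j] by simp
  qed
  then have "a i * w i = 0"
    by (rule invertible_left_kernel[OF invertible_BMmat[OF p], of "\<lambda>i. a i * w i" k'])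
  then show ?thesis using lam_nz[of i] by (simp add: w_def)
qed

text \<open>Here the signs in \<open>dressing_t\<close> agree with those of T, so component
  \<open>k\<close> is governed by its own matrix \<open>BMmat k\<close>.\<close>

lemma x_lax_V:
  assumes p: "p \<in> \<Omega>N"
  shows "dderiv (0, 1) (\<lambda>q. x i q $ k) p = (lax_V QN (a i) p *v x i p) $ k"
proof -
  define w where "w = (\<lambda>i. dderiv (0, 1) (\<lambda>q. x i q $ k) p - (lax_V QN (a i) p *v x i p) $ k)"
  have pO: "p \<in> \<Omega>" using p OmegaN_sub by blast
  have "(\<Sum>i\<in>UNIV. w i * BMmat k \<sigma> lam (yp p) $ i $ j) = 0" for j
  proof -
    have "0 = (\<Sum>i\<in>UNIV. w i
      * (bra_J \<sigma> (y i p) (y j p) / (lam j - a i) - sgn3 k * bra_J3 \<sigma> (y i p) (y j p) / (lam j + a i)))"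
      using dressing_t[OF p lam_poles lax_solutionD(1,3)[OF lax_y pO], of j k]
      by (simp add: dderiv_Tmat_y[OF p] Tmat_y[OF p] w_def)
    also have "\<dots> = - (\<Sum>i\<in>UNIV. w i * BMmat k \<sigma> lam (yp p) $ i $ j)"
      unfolding sum_negf[symmetric] by (intro sum.cong refl) (simp add: BMmat_nth algebra_simps)
    finally show ?thesis by simp
  qed
  then have "w i = 0"
    by (rule invertible_left_kernel[OF invertible_BMmat[OF p], of w k])
  then show ?thesis by (simp add: w_def)
qed

lemma darboux_lax_solution:
  assumes z: "z \<noteq> 0" "\<And>i. z \<noteq> a i" "\<And>i. z \<noteq> - a i" and \<Phi>: "lax_solution Q z \<Omega>N \<Phi>"
  shows "lax_solution QN z \<Omega>N (\<lambda>p. T z p *v \<Phi> p)"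
  unfolding lax_solution_def
proof (intro ballI conjI)
  fix p assume p: "p \<in> \<Omega>N"
  note \<Phi>p = lax_solutionD[OF \<Phi> p]
  show d: "(\<lambda>p. T z p *v \<Phi> p) differentiable (at p)"
    by (intro differentiable_vecI dderiv_Tmat(1)[OF p \<Phi>p(1)])
  show "dx (\<lambda>p. T z p *v \<Phi> p) p = lax_U QN z p *v (T z p *v \<Phi> p)"
    using dressing_x[OF p z \<Phi>p(1,2)]
    by (simp add: dx_eq_dderiv[OF d] vec_eq_iff dderiv_vec_nth[OF d] x_lax_U[OF p])
  show "dt (\<lambda>p. T z p *v \<Phi> p) p = lax_V QN z p *v (T z p *v \<Phi> p)"
    using dressing_t[OF p z(2,3) \<Phi>p(1,3)]
    by (simp add: dt_eq_dderiv[OF d] vec_eq_iff dderiv_vec_nth[OF d] x_lax_V[OF p])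
qed

section \<open>The dressed equation\<close>

definition moment where "moment k l n p = (\<Sum>i\<in>UNIV. a i ^ n * (x i p $ k * cnj (y i p $ l)))"

lemma smooth_moment: "smooth_on \<Omega>N (moment k l n)"
  unfolding moment_def
  by (intro smooth_on_mult[OF open_OmegaN] smooth_on_const smooth_on_sum[OF open_OmegaN]
      smooth_on_cnj[OF open_OmegaN] smooth_x smooth_on_subset[OF smooth_y OmegaN_sub])

lemma diff_moment: "p \<in> \<Omega>N \<Longrightarrow> moment k l n differentiable (at p)"
  by (rule smooth_on_differentiable[OF smooth_moment])

lemma dderiv_moment:
  assumes p: "p \<in> \<Omega>N"
  shows "dderiv e (moment k l n) p = (\<Sum>i\<in>UNIV. a i ^ n * (x i p $ k * cnj (dderiv e (y i) p $ l)
     + dderiv e (\<lambda>q. x i q $ k) p * cnj (y i p $ l)))"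
proof -
  have eq: "moment k l n = (\<lambda>q. \<Sum>i\<in>UNIV. a i ^ n * (x i q $ k * cnj (y i q $ l)))"
    by (simp add: fun_eq_iff moment_def)
  note d = diff_x[OF p] differentiable_vec_nth[OF diff_y[OF p]] differentiable_const[of _ "at p"]
    differentiable_mult differentiable_cnj
  show ?thesis unfolding eq
    by (simp add: d dderiv_sum dderiv_mult dderiv_const dderiv_cnj dderiv_vec_nth[OF diff_y[OF p]])
qed

lemma moment_duality: "p \<in> \<Omega>N \<Longrightarrow> k \<noteq> 1 \<Longrightarrow> moment 1 k 0 p = - cnj (moment k 1 0 p)"
  using xvec_duality[OF sigma, of lam "yp p" k] by (simp add: moment_def \<Omega>N_def)

lemma dderiv_y_nth:
  assumes p: "p \<in> \<Omega>N"
  shows "cnj (dderiv (1, 0) (y i) p $ k) = - \<i> / (a i)\<^sup>2 * (sgn3 k * cnj (y i p $ k))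
      + cnj ((Qmat \<sigma> (dderiv (1, 0) u1 p) (dderiv (1, 0) u2 p) *v y i p) $ k) / a i"
    and "cnj (dderiv (0, 1) (y i) p $ k) = - \<i> * sgn3 k * ((a i)\<^sup>2 / 4 * cnj (y i p $ k)
      + cnj ((Q p *v (Q p *v y i p)) $ k) / 2 - a i / 2 * cnj ((Q p *v y i p) $ k))"
proof -
  have pO: "p \<in> \<Omega>" using p OmegaN_sub by blast
  have s: "cnj (sgn3 k) = sgn3 k" by (simp add: sgn3_def)
  show "cnj (dderiv (1, 0) (y i) p $ k) = - \<i> / (a i)\<^sup>2 * (sgn3 k * cnj (y i p $ k))
      + cnj ((Qmat \<sigma> (dderiv (1, 0) u1 p) (dderiv (1, 0) u2 p) *v y i p) $ k) / a i"
    by (simp add: lax_solutionD(2)[OF lax_y pO] lax_U_vec dx_Q[OF p] sigma3_vec s)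
  show "cnj (dderiv (0, 1) (y i) p $ k) = - \<i> * sgn3 k * ((a i)\<^sup>2 / 4 * cnj (y i p $ k)
      + cnj ((Q p *v (Q p *v y i p)) $ k) / 2 - a i / 2 * cnj ((Q p *v y i p) $ k))"
    by (simp add: lax_solutionD(3)[OF lax_y pO] lax_V_vec sigma3_vec s)
qed

lemma dderiv_x_nth:
  assumes p: "p \<in> \<Omega>N"
  shows "dderiv (1, 0) (\<lambda>q. x i q $ k) p = \<i> / (a i)\<^sup>2 * (sgn3 k * x i p $ k)
      + (Qmat \<sigma> (dderiv (1, 0) v1 p) (dderiv (1, 0) v2 p) *v x i p) $ k / a i"
    and "dderiv (0, 1) (\<lambda>q. x i q $ k) p = \<i> * sgn3 k * ((a i)\<^sup>2 / 4 * x i p $ k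
      + (Qmat \<sigma> (v1 p) (v2 p) *v (Qmat \<sigma> (v1 p) (v2 p) *v x i p)) $ k / 2
      - a i / 2 * (Qmat \<sigma> (v1 p) (v2 p) *v x i p) $ k)"
  by (simp_all add: x_lax_U[OF p] x_lax_V[OF p] lax_U_vec lax_V_vec dx_QN[OF p] QN_eq[OF p] sigma3_vec)

lemma cnj_sigma: "cnj \<sigma> = \<sigma>" using sigma by auto

text \<open>Both indices lie in the same block of \<open>sigma3\<close>, so the terms with
  \<open>1 / (a i)^2\<close> cancel. The terms with \<open>1 / a i\<close> lower the exponent from 1
  to 0.\<close>

lemma dderiv_x_moment_111:
  assumes p: "p \<in> \<Omega>N"
  shows "dderiv (1, 0) (moment 1 1 1) p = cnj (dderiv (1, 0) v1 p) * moment 2 1 0 p + \<sigma> * (cnj (dderiv (1, 0) v2 p) * moment 3 1 0 p)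
    + dderiv (1, 0) u1 p * moment 1 2 0 p + \<sigma> * (dderiv (1, 0) u2 p * moment 1 3 0 p)"
  unfolding dderiv_moment[OF p] moment_def sum_distrib_left sum.distrib[symmetric] dderiv_y_nth[OF p] dderiv_x_nth[OF p]
  by (intro sum.cong refl) (use lam_nz in \<open>simp add: Qmat_vec cnj_sigma field_simps power2_eq_square\<close>)

text \<open>The first two moments again stay within one block. In the third the blocks differ, so
  the \<open>1 / (a i)^2\<close> terms add up to the factor \<open>- 2 * \<i>\<close> and reduce
  exponent 2 to 0. Carrying \<open>w\<close> along with \<open>k\<close> treats both dressed
  components at once.\<close>

lemma dderiv_x_moment:
  assumes p: "p \<in> \<Omega>N" and k: "k = 2 \<and> w = v1 \<or> k = 3 \<and> w = v2"
  shows "dderiv (1, 0) (moment k 2 1) p = dderiv (1, 0) w p * moment 1 2 0 p + cnj (dderiv (1, 0) u1 p) * moment k 1 0 p"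
    and "dderiv (1, 0) (moment k 3 1) p = dderiv (1, 0) w p * moment 1 3 0 p + cnj (dderiv (1, 0) u2 p) * moment k 1 0 p"
    and "dderiv (1, 0) (moment k 1 2) p = - 2 * \<i> * moment k 1 0 p + dderiv (1, 0) w p * moment 1 1 1 p
      + dderiv (1, 0) u1 p * moment k 2 1 p + \<sigma> * (dderiv (1, 0) u2 p * moment k 3 1 p)"
proof -
  have 1: "(Qmat \<sigma> (dderiv (1, 0) v1 p) (dderiv (1, 0) v2 p) *v s) $ k = dderiv (1, 0) w p * s $ 1"
    and 2: "sgn3 k = -1" for s
    using k by (auto simp: Qmat_vec)
  note eqs = dderiv_moment[OF p] moment_def sum_distrib_left sum.distrib[symmetric] dderiv_y_nth[OF p] dderiv_x_nth[OF p] 1 2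
  show "dderiv (1, 0) (moment k 2 1) p = dderiv (1, 0) w p * moment 1 2 0 p + cnj (dderiv (1, 0) u1 p) * moment k 1 0 p"
    unfolding eqs
    by (intro sum.cong refl) (use lam_nz in \<open>simp add: Qmat_vec cnj_sigma field_simps power2_eq_square\<close>)
  show "dderiv (1, 0) (moment k 3 1) p = dderiv (1, 0) w p * moment 1 3 0 p + cnj (dderiv (1, 0) u2 p) * moment k 1 0 p"
    unfolding eqs
    by (intro sum.cong refl) (use lam_nz in \<open>simp add: Qmat_vec cnj_sigma field_simps power2_eq_square\<close>)
  show "dderiv (1, 0) (moment k 1 2) p = - 2 * \<i> * moment k 1 0 p + dderiv (1, 0) w p * moment 1 1 1 p
      + dderiv (1, 0) u1 p * moment k 2 1 p + \<sigma> * (dderiv (1, 0) u2 p * moment k 3 1 p)"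
    unfolding eqs
    by (intro sum.cong refl) (use lam_nz in \<open>simp add: Qmat_vec cnj_sigma field_simps power2_eq_square\<close>)
qed

text \<open>The t-derivative of \<open>moment k 1 0\<close> read off from the equations with V, kept
  as a function of \<open>p\<close> so that it can be differentiated in x.\<close>

definition moment_t where "moment_t k w p = (- \<i> / 2) * moment k 1 2 p
   + (- \<i> / 2) * (w p * (cnj (v1 p) * moment 2 1 0 p + \<sigma> * (cnj (v2 p) * moment 3 1 0 p)))
   + (\<i> / 2) * (w p * moment 1 1 1 p)
   + (- \<i> / 2) * ((u1 p * cnj (u1 p) + \<sigma> * (u2 p * cnj (u2 p))) * moment k 1 0 p)
   + (\<i> / 2) * (u1 p * moment k 2 1 p + \<sigma> * (u2 p * moment k 3 1 p))"

lemma dderiv_t_moment: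
  assumes p: "p \<in> \<Omega>N" and k: "k = 2 \<and> w = v1 \<or> k = 3 \<and> w = v2"
  shows "dderiv (0, 1) (moment k 1 0) p = moment_t k w p"
proof -
  have 1: "(Qmat \<sigma> (v1 p) (v2 p) *v s) $ k = w p * s $ 1" and 2: "sgn3 k = -1" for s
    using k by (auto simp: Qmat_vec)
  show ?thesis
    unfolding dderiv_moment[OF p] moment_t_def moment_def sum_distrib_left sum.distrib[symmetric] dderiv_y_nth[OF p]
      dderiv_x_nth[OF p] 1 2
    by (intro sum.cong refl) (simp add: Qmat_vec cnj_sigma field_simps power2_eq_square)
qed

text \<open>The result involves only moments of exponent 0, their conjugates and their
  x-derivatives. By \<open>v_eq_moment\<close> these are half the differences of new and old
  potentials, so the system closes.\<close>

lemma dderiv_x_moment_t: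
  assumes p: "p \<in> \<Omega>N" and k: "k = 2 \<and> w = v1 \<or> k = 3 \<and> w = v2"
  defines "D \<equiv> \<lambda>f. dderiv (1, 0) f p"
  shows "D (moment_t k w) = - moment k 1 0 p
    + (- \<i> / 2) * (D w * (cnj (v1 p) * moment 2 1 0 p + \<sigma> * (cnj (v2 p) * moment 3 1 0 p))
        + w p * (cnj (v1 p) * D (moment 2 1 0) + \<sigma> * (cnj (v2 p) * D (moment 3 1 0))
          + D u1 * cnj (moment 2 1 0 p) + \<sigma> * (D u2 * cnj (moment 3 1 0 p))))
    + (- \<i> / 2) * ((D u1 * cnj (u1 p) + u1 p * cnj (D u1) + \<sigma> * (D u2 * cnj (u2 p) + u2 p * cnj (D u2))) * moment k 1 0 p
        + (u1 p * cnj (u1 p) + \<sigma> * (u2 p * cnj (u2 p))) * D (moment k 1 0))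
    + (\<i> / 2) * (u1 p * (cnj (D u1) * moment k 1 0 p - D w * cnj (moment 2 1 0 p))
        + \<sigma> * (u2 p * (cnj (D u2) * moment k 1 0 p - D w * cnj (moment 3 1 0 p))))"
proof -
  have w: "w differentiable (at p)" using k diff_v[OF p] by auto
  note d = w diff_v[OF p] diff_u[OF p] diff_moment[OF p] differentiable_const[of _ "at p"]
    differentiable_mult differentiable_cnj differentiable_add
  have eq: "moment_t k w = (\<lambda>p. (- \<i> / 2) * moment k 1 2 p
   + (- \<i> / 2) * (w p * (cnj (v1 p) * moment 2 1 0 p + \<sigma> * (cnj (v2 p) * moment 3 1 0 p)))
   + (\<i> / 2) * (w p * moment 1 1 1 p)
   + (- \<i> / 2) * ((u1 p * cnj (u1 p) + \<sigma> * (u2 p * cnj (u2 p))) * moment k 1 0 p)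
   + (\<i> / 2) * (u1 p * moment k 2 1 p + \<sigma> * (u2 p * moment k 3 1 p)))"
    by (simp add: fun_eq_iff moment_t_def)
  have "D (moment_t k w) = (- \<i> / 2) * D (moment k 1 2)
   + (- \<i> / 2) * (D w * (cnj (v1 p) * moment 2 1 0 p + \<sigma> * (cnj (v2 p) * moment 3 1 0 p))
       + w p * (cnj (D v1) * moment 2 1 0 p + cnj (v1 p) * D (moment 2 1 0)
          + \<sigma> * (cnj (D v2) * moment 3 1 0 p + cnj (v2 p) * D (moment 3 1 0))))
   + (\<i> / 2) * (D w * moment 1 1 1 p + w p * D (moment 1 1 1))
   + (- \<i> / 2) * ((D u1 * cnj (u1 p) + u1 p * cnj (D u1) + \<sigma> * (D u2 * cnj (u2 p) + u2 p * cnj (D u2))) * moment k 1 0 p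
       + (u1 p * cnj (u1 p) + \<sigma> * (u2 p * cnj (u2 p))) * D (moment k 1 0))
   + (\<i> / 2) * (D u1 * moment k 2 1 p + u1 p * D (moment k 2 1) + \<sigma> * (D u2 * moment k 3 1 p + u2 p * D (moment k 3 1)))"
    unfolding eq D_def
    by (simp only: d dderiv_add dderiv_mult dderiv_const dderiv_cnj) (simp add: algebra_simps)
  \<comment> \<open>The derivative of \<open>moment k 1 2\<close> produces the exponent-1 moments
    that cancel the remaining ones; the terms with derivatives of \<open>v1\<close> and
    \<open>v2\<close> conjugated cancel against the derivative of \<open>moment 1 1 1\<close>.
    Duality then removes \<open>moment 1 2 0\<close> and \<open>moment 1 3 0\<close>.\<close>
  also have "\<dots> = - moment k 1 0 p
    + (- \<i> / 2) * (D w * (cnj (v1 p) * moment 2 1 0 p + \<sigma> * (cnj (v2 p) * moment 3 1 0 p))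
        + w p * (cnj (v1 p) * D (moment 2 1 0) + \<sigma> * (cnj (v2 p) * D (moment 3 1 0))
          + D u1 * cnj (moment 2 1 0 p) + \<sigma> * (D u2 * cnj (moment 3 1 0 p))))
    + (- \<i> / 2) * ((D u1 * cnj (u1 p) + u1 p * cnj (D u1) + \<sigma> * (D u2 * cnj (u2 p) + u2 p * cnj (D u2))) * moment k 1 0 p
        + (u1 p * cnj (u1 p) + \<sigma> * (u2 p * cnj (u2 p))) * D (moment k 1 0))
    + (\<i> / 2) * (u1 p * (cnj (D u1) * moment k 1 0 p - D w * cnj (moment 2 1 0 p))
        + \<sigma> * (u2 p * (cnj (D u2) * moment k 1 0 p - D w * cnj (moment 3 1 0 p))))"
    unfolding D_def dderiv_x_moment[OF p k] dderiv_x_moment_111[OF p]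
    by (simp add: moment_duality[OF p] field_simps)
  finally show ?thesis .
qed

lemma v_eq_moment: "v1 = (\<lambda>p. u1 p + 2 * moment 2 1 0 p)" "v2 = (\<lambda>p. u2 p + 2 * moment 3 1 0 p)"
  by (simp_all add: fun_eq_iff v_eq moment_def)

text \<open>Symmetry of mixed partials for both the new and the old potential moves the x-derivative
  outside, where the formula for the t-derivative of the moment on all of \<open>\<Omega>N\<close>
  can be inserted.\<close>

lemma dt_dx_v:
  assumes p: "p \<in> \<Omega>N"
    and k: "k = 2 \<and> w = v1 \<and> u = u1 \<or> k = 3 \<and> w = v2 \<and> u = u2"
  shows "dt (dx w) p = dt (dx u) p + 2 * dderiv (1, 0) (moment_t k w) p"
    and "dderiv (1, 0) w p = dderiv (1, 0) u p + 2 * dderiv (1, 0) (moment k 1 0) p"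
proof -
  have k': "k = 2 \<and> w = v1 \<or> k = 3 \<and> w = v2" using k by auto
  have w: "w = (\<lambda>p. u p + 2 * moment k 1 0 p)" using k v_eq_moment by auto
  have su: "smooth_on \<Omega>N u" and sw: "smooth_on \<Omega>N w"
    using k smooth_on_subset[OF smooth_u(1) OmegaN_sub] smooth_on_subset[OF smooth_u(2) OmegaN_sub] smooth_v by auto
  have D: "dderiv e w q = dderiv e u q + 2 * dderiv e (moment k 1 0) q" if q: "q \<in> \<Omega>N" for e q
    unfolding w
    by (simp add: dderiv_add dderiv_mult dderiv_const differentiable_mult smooth_on_differentiable[OF su q] diff_moment[OF q])
  show "dderiv (1, 0) w p = dderiv (1, 0) u p + 2 * dderiv (1, 0) (moment k 1 0) p" by (rule D[OF p])
  have sFt: "smooth_on \<Omega>N (dderiv (0, 1) (moment k 1 0))"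
    by (rule smooth_on_dderiv[OF open_OmegaN smooth_moment]) simp
  have sut: "smooth_on \<Omega>N (dderiv (0, 1) u)"
    by (rule smooth_on_dderiv[OF open_OmegaN su]) simp
  have "dt (dx w) p = dderiv (1, 0) (dderiv (0, 1) w) p"
    by (rule dt_dx_eq[OF open_OmegaN p sw])
  also have "\<dots> = dderiv (1, 0) (\<lambda>q. dderiv (0, 1) u q + 2 * dderiv (0, 1) (moment k 1 0) q) p"
    by (rule dderiv_cong_open[OF open_OmegaN p D])
  also have "\<dots> = dderiv (1, 0) (dderiv (0, 1) u) p + 2 * dderiv (1, 0) (dderiv (0, 1) (moment k 1 0)) p"
    by (simp add: dderiv_add dderiv_mult dderiv_const differentiable_mult smooth_on_differentiable[OF sut p]
        smooth_on_differentiable[OF sFt p])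
  also have "dderiv (1, 0) (dderiv (0, 1) u) p = dt (dx u) p"
    by (rule dt_dx_eq[OF open_OmegaN p su, symmetric])
  also have "dderiv (1, 0) (dderiv (0, 1) (moment k 1 0)) p = dderiv (1, 0) (moment_t k w) p"
    by (rule dderiv_cong_open[OF open_OmegaN p dderiv_t_moment[OF _ k']])
  finally show "dt (dx w) p = dt (dx u) p + 2 * dderiv (1, 0) (moment_t k w) p" .
qed

lemma darboux_cFL_solution:
  assumes "smooth_cFL_solution \<sigma> \<Omega> u1 u2"
  shows "smooth_cFL_solution \<sigma> \<Omega>N v1 v2"
proof -
  have "dt (dx v1) p + v1 p + \<i> * (v1 p * cnj (v1 p) + \<sigma> / 2 * (v2 p * cnj (v2 p))) * dx v1 p
          + \<i> / 2 * \<sigma> * v1 p * cnj (v2 p) * dx v2 p = 0 \<and>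
        dt (dx v2) p + v2 p + \<i> * (\<sigma> * (v2 p * cnj (v2 p)) + 1 / 2 * (v1 p * cnj (v1 p))) * dx v2 p
          + \<i> / 2 * v2 p * cnj (v1 p) * dx v1 p = 0" if p: "p \<in> \<Omega>N" for p
  proof -
    have pO: "p \<in> \<Omega>" using p OmegaN_sub by blast
    \<comment> \<open>Once everything is written in these values, those of the old potentials, their
      x-derivatives and conjugates, the dressed equation becomes a polynomial identity.\<close>
    define f2 f3 f2' f3' where "f2 = moment 2 1 0 p" and "f3 = moment 3 1 0 p"
      and "f2' = dderiv (1, 0) (moment 2 1 0) p" and "f3' = dderiv (1, 0) (moment 3 1 0) p"
    \<comment> \<open>From here on \<open>a\<close> is the value of \<open>u1\<close> and hides the
      conjugated spectral parameter.\<close>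
    define a b a' b' where "a = u1 p" and "b = u2 p" and "a' = dderiv (1, 0) u1 p" and "b' = dderiv (1, 0) u2 p"
    note defs = f2_def[symmetric] f3_def[symmetric] f2'_def[symmetric] f3'_def[symmetric]
      a_def[symmetric] b_def[symmetric] a'_def[symmetric] b'_def[symmetric]
    have vx: "dderiv (1, 0) v1 p = a' + 2 * f2'" "dderiv (1, 0) v2 p = b' + 2 * f3'"
      using dt_dx_v(2)[OF p, of 2 v1 u1] dt_dx_v(2)[OF p, of 3 v2 u2] by (simp_all add: defs)
    have v: "v1 p = a + 2 * f2" "v2 p = b + 2 * f3"
      unfolding a_def b_def f2_def f3_def by (rule fun_cong[OF v_eq_moment(1)] fun_cong[OF v_eq_moment(2)])+
    have dxu: "dx u1 p = a'" "dx u2 p = b'" "dx v1 p = a' + 2 * f2'" "dx v2 p = b' + 2 * f3'"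
      using dx_eq_dderiv[OF diff_u(1)[OF p]] dx_eq_dderiv[OF diff_u(2)[OF p]]
        dx_eq_dderiv[OF diff_v(1)[OF p]] dx_eq_dderiv[OF diff_v(2)[OF p]] vx by (simp_all add: defs)
    have ut1: "dt (dx u1) p = - (a + \<i> * (a * cnj a + \<sigma> / 2 * (b * cnj b)) * a' + \<i> / 2 * \<sigma> * a * cnj b * b')"
      and ut2: "dt (dx u2) p = - (b + \<i> * (\<sigma> * (b * cnj b) + 1 / 2 * (a * cnj a)) * b' + \<i> / 2 * b * cnj a * a')"
      using bspec[OF conjunct2[OF conjunct2[OF assms[unfolded smooth_cFL_solution_def]]] pO, unfolded dxu defs]
      by (simp_all only: eq_neg_iff_add_eq_0 add.assoc)
    have k: "(2 :: 3) = 2 \<and> v1 = v1 \<or> (2 :: 3) = 3 \<and> v1 = v2" "(3 :: 3) = 2 \<and> v2 = v1 \<or> (3 :: 3) = 3 \<and> v2 = v2"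
      by simp_all
    note R2 = dderiv_x_moment_t[OF p k(1), unfolded v vx, unfolded defs]
      and R3 = dderiv_x_moment_t[OF p k(2), unfolded v vx, unfolded defs]
    have vt1: "dt (dx v1) p = dt (dx u1) p + 2 * dderiv (1, 0) (moment_t 2 v1) p"
      and vt2: "dt (dx v2) p = dt (dx u2) p + 2 * dderiv (1, 0) (moment_t 3 v2) p"
      using dt_dx_v(1)[OF p, of 2 v1 u1] dt_dx_v(1)[OF p, of 3 v2 u2] by simp_all
    show ?thesis
    proof
      show "dt (dx v1) p + v1 p + \<i> * (v1 p * cnj (v1 p) + \<sigma> / 2 * (v2 p * cnj (v2 p))) * dx v1 p
          + \<i> / 2 * \<sigma> * v1 p * cnj (v2 p) * dx v2 p = 0"
        unfolding vt1 ut1 dxu v R2 by (simp add: field_simps)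
      show "dt (dx v2) p + v2 p + \<i> * (\<sigma> * (v2 p * cnj (v2 p)) + 1 / 2 * (v1 p * cnj (v1 p))) * dx v2 p
          + \<i> / 2 * v2 p * cnj (v1 p) * dx v1 p = 0"
        unfolding vt2 ut2 dxu v R3 by (simp add: field_simps)
    qed
  qed
  then show ?thesis using smooth_v by (simp add: smooth_cFL_solution_def)
qed

end

theorem mainTheorem4:
  fixes \<sigma> :: complex
    and \<Omega> :: "(real \<times> real) set"
    and u1 u2 :: "real \<times> real \<Rightarrow> complex"
    and lam :: "'n::finite \<Rightarrow> complex"
    and y :: "'n \<Rightarrow> real \<times> real \<Rightarrow> complex^3"
  assumes "\<sigma> = 1 \<or> \<sigma> = -1"
    and "open \<Omega>"
    and "smooth_cFL_solution \<sigma> \<Omega> u1 u2"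
    and "\<And>i. lam i \<notin> \<real> \<union> range (\<lambda>r. \<i> * complex_of_real r)"
    and "\<And>i j. i \<noteq> j \<Longrightarrow> (lam i)\<^sup>2 \<noteq> (lam j)\<^sup>2"
    and "\<And>i j. (cnj (lam i))\<^sup>2 \<noteq> (lam j)\<^sup>2"
    and "\<And>i. lax_solution (\<lambda>p. Qmat \<sigma> (u1 p) (u2 p)) (lam i) \<Omega> (y i)"
  shows "let Q = (\<lambda>p. Qmat \<sigma> (u1 p) (u2 p));
             yp = (\<lambda>p i. y i p);
             \<Omega>N = {p \<in> \<Omega>. invertible (Bmat \<sigma> lam (yp p)) \<and> invertible (Mmat \<sigma> lam (yp p))};
             QN = (\<lambda>p. Q_dressed \<sigma> lam (yp p) (Q p));
             u1N = (\<lambda>p. u_dressed \<sigma> lam (yp p) (vector [u1 p, u2 p]) $ 1);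
             u2N = (\<lambda>p. u_dressed \<sigma> lam (yp p) (vector [u1 p, u2 p]) $ 2)
         in (\<forall>p\<in>\<Omega>N. QN p = Qmat \<sigma> (u1N p) (u2N p)) \<and>
            (\<forall>\<zeta> \<Phi>. \<zeta> \<noteq> 0 \<longrightarrow> (\<forall>i. \<zeta> \<noteq> cnj (lam i) \<and> \<zeta> \<noteq> - cnj (lam i)) \<longrightarrow>
               lax_solution Q \<zeta> \<Omega>N \<Phi> \<longrightarrow>
               lax_solution QN \<zeta> \<Omega>N (\<lambda>p. Tmat \<sigma> lam (yp p) \<zeta> *v \<Phi> p)) \<and>
            smooth_cFL_solution \<sigma> \<Omega>N u1N u2N"
proof -
  interpret darboux \<sigma> \<Omega> u1 u2 lam y
  proof
    \<comment> \<open>Zero is real and hence among the excluded parameters.\<close>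
    show "lam i \<noteq> 0" for i using assms(4)[of i] by auto
  qed (use assms in \<open>auto simp: smooth_cFL_solution_def\<close>)
  show ?thesis
    unfolding Let_def \<Omega>N_def[symmetric]
    using QN_eq darboux_lax_solution darboux_cFL_solution[OF assms(3)] by blast
qed

end
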